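(* Let $P_1,P_2$ be fixed probability distributions on $[0,\infty)$, let $X_1\sim P_1$ and $Y_1\sim P_2$, and suppose that $\mathbf{E}X_1<\infty$ and $\mathbf{E}Y_1<\infty$. Let $\beta\in(0,+\infty)$, and let $m,n\to\infty$ in such a way that $m/n\to\beta$. Let $d=d(v_1)$ be the degree of vertex $v_1$ in the inhomogeneous random intersection graph $G(P_1,P_2,n,m)$. Then $d$ converges in distribution to the random variable $$d_*=\sum_{j=1}^{\Lambda_1}\tau_j,$$ where $\tau_1,\tau_2,\dots$ are independent and identically distributed random variables, independent of the random variable $\Lambda_1$, with distributions given, for $r=0,1,2,\dots$, by $$\mathbf{P}(\tau_1=r)=\frac{r+1}{\mathbf{E}\Lambda_2}\,\mathbf{P}(\Lambda_2=r+1),\qquad \mathbf{P}(\Lambda_i=r)=\mathbf{E}\left(e^{-\lambda_i}\frac{\lambda_i^r}{r!}\right),\quad i=1,2,$$ with $\lambda_1=Y_1a_1\beta^{1/2}$, $\lambda_2=X_1b_1\beta^{-1/2}$, $a_1=\mathbf{E}X_1$ and $b_1=\mathbf{E}Y_1$.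
   Context: Inhomogeneous random intersection graph $G(P_1,P_2,n,m)$: let $X_1,X_2,\dots$ and $Y_1,Y_2,\dots$ be independent non-negative random variables (all jointly independent) such that each $X_i$ has distribution $P_1$ and each $Y_j$ has distribution $P_2$. Given the realized values $X=\{X_i\}_{i=1}^m$ and $Y=\{Y_j\}_{j=1}^n$, let $H_{X,Y}$ be the random bipartite graph with bipartition $V=\{v_1,\dots,v_n\}$, $W=\{w_1,\dots,w_m\}$ in which the edges $\{w_i,v_j\}$ are inserted independently for each $(i,j)\in[m]\times[n]$, with probabilities $p_{ij}=\min\{1,X_iY_j(nm)^{-1/2}\}$. The graph $G(P_1,P_2,n,m)$ has vertex set $V$, and two distinct vertices $v',v''\in V$ are adjacent whenever they have a common neighbour in $H_{X,Y}$. The degree of $v_1$ is the number of vertices of $V\setminus\{v_1\}$ adjacent to $v_1$. The limit is along any sequence of pairs $(n,m)$ with $n,m\to\infty$ and $m/n\to\beta$. An empty sum equals $0$. Convention for the degenerate case: $\mathbf{E}\Lambda_2=a_1b_1\beta^{-1/2}$, so if $\mathbf{E}\Lambda_2=0$ then $a_1b_1=0$ and $\Lambda_1=0$ almost surely; in this case $d_*$ is understood to be $0$ (the distribution of the $\tau_j$ is then irrelevant). *)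

theory Defs
  imports "HOL-Probability.Probability"
begin

definition edge_prob :: "nat \<Rightarrow> nat \<Rightarrow> real \<Rightarrow> real \<Rightarrow> real" where
  "edge_prob n m x y = min 1 (x * y / sqrt (real n * real m))"

text \<open>
  Attributes are indexed by \<open>{1..m}\<close> and vertices by \<open>{1..n}\<close>. A bipartite graph is encoded by its
  indicator function: \<open>H (i, j)\<close> holds iff attribute \<open>i\<close> and vertex \<open>j\<close> are joined.
\<close>

definition bipartite_graph_pmf ::
  "nat \<Rightarrow> nat \<Rightarrow> (nat \<Rightarrow> real) \<Rightarrow> (nat \<Rightarrow> real) \<Rightarrow> (nat \<times> nat \<Rightarrow> bool) pmf" where
  "bipartite_graph_pmf n m X Y =
     Pi_pmf ({1..m} \<times> {1..n}) False (\<lambda>(i, j). bernoulli_pmf (edge_prob n m (X i) (Y j)))"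

definition intersection_graph :: "nat \<Rightarrow> nat \<Rightarrow> (nat \<times> nat \<Rightarrow> bool) \<Rightarrow> (nat \<times> nat) set" where
  "intersection_graph n m H =
     {(u, v). u \<in> {1..n} \<and> v \<in> {1..n} \<and> u \<noteq> v \<and> (\<exists>i\<in>{1..m}. H (i, u) \<and> H (i, v))}"

definition vertex_degree :: "(nat \<times> nat) set \<Rightarrow> nat \<Rightarrow> nat" where
  "vertex_degree G v = card {u. (v, u) \<in> G}"

text \<open>The law of the graph, given by its (symmetric, irreflexive) adjacency relation.\<close>

definition random_intersection_graph ::
  "real measure \<Rightarrow> real measure \<Rightarrow> nat \<Rightarrow> nat \<Rightarrow> (nat \<times> nat) set measure" where
  "random_intersection_graph P1 P2 n m =
     (Pi\<^sub>M {1..m} (\<lambda>_. P1) \<Otimes>\<^sub>M Pi\<^sub>M {1..n} (\<lambda>_. P2)) \<bind>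
       (\<lambda>(X, Y). measure_pmf (map_pmf (intersection_graph n m) (bipartite_graph_pmf n m X Y)))"

text \<open>
  Since \<open>bind\<close> is only meaningful for measurable kernels, we check that the edge kernel is one and
  hence that the law above is a probability measure on all sets of graphs.
\<close>

lemma measurable_bipartite_kernel:
  assumes "sets P1 = sets borel" "sets P2 = sets borel"
  shows "(\<lambda>(X, Y). measure_pmf (map_pmf (intersection_graph n m) (bipartite_graph_pmf n m X Y)))
    \<in> measurable (Pi\<^sub>M {1..m} (\<lambda>_. P1) \<Otimes>\<^sub>M Pi\<^sub>M {1..n} (\<lambda>_. P2)) (subprob_algebra (count_space UNIV))"
    (is "?K \<in> measurable ?M _")
proof (rule measurable_subprob_algebra)
  fix B :: "(nat \<times> nat) set set"
  let ?I = "{1..m} \<times> {1..n}"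
  let ?F = "PiE_dflt ?I False (\<lambda>_. UNIV :: bool set)"
  let ?A = "intersection_graph n m -` B"
  have fin: "finite ?F" by (intro finite_PiE_dflt) auto
  have bern: "pmf (bernoulli_pmf p) b = (if b then min 1 (max 0 p) else 1 - min 1 (max 0 p))" for p b
    by (simp add: bernoulli_pmf.rep_eq)
  have "emeasure (?K (X, Y)) B =
      ennreal (\<Sum>f\<in>?F \<inter> ?A. \<Prod>(i, j)\<in>?I. pmf (bernoulli_pmf (edge_prob n m (X i) (Y j))) (f (i, j)))"
    for X Y
  proof -
    let ?p = "bipartite_graph_pmf n m X Y"
    have sub: "set_pmf ?p \<subseteq> ?F"
      unfolding bipartite_graph_pmf_def
      by (rule order_trans[OF set_Pi_pmf_subset']) (auto simp: PiE_dflt_def)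
    have "emeasure (?K (X, Y)) B = ennreal (measure_pmf.prob ?p ?A)"
      by (simp add: measure_pmf.emeasure_eq_measure)
    also have "measure_pmf.prob ?p ?A = measure_pmf.prob ?p (?F \<inter> ?A)"
      using sub by (intro measure_prob_cong_0) (auto simp: set_pmf_eq)
    also have "\<dots> = (\<Sum>f\<in>?F \<inter> ?A. pmf ?p f)"
      using fin by (simp add: measure_measure_pmf_finite)
    also have "\<dots> = (\<Sum>f\<in>?F \<inter> ?A. \<Prod>(i, j)\<in>?I. pmf (bernoulli_pmf (edge_prob n m (X i) (Y j))) (f (i, j)))"
    proof (intro sum.cong refl)
      fix f assume "f \<in> ?F \<inter> ?A"
      then have "f x = False" if "x \<notin> ?I" for x
        using that by (cases x) (force simp: PiE_dflt_def)
      then show "pmf ?p f = (\<Prod>(i, j)\<in>?I. pmf (bernoulli_pmf (edge_prob n m (X i) (Y j))) (f (i, j)))"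
        unfolding bipartite_graph_pmf_def
        by (subst pmf_Pi') (auto intro!: prod.cong)
    qed
    finally show ?thesis .
  qed
  then have eq: "(\<lambda>a. emeasure (?K a) B) = (\<lambda>a. ennreal (\<Sum>f\<in>?F \<inter> ?A. \<Prod>ij\<in>?I.
      pmf (bernoulli_pmf (edge_prob n m (fst a (fst ij)) (snd a (snd ij)))) (f ij)))"
    by (auto simp: fun_eq_iff case_prod_beta)
  have mX: "(\<lambda>a. fst a i) \<in> borel_measurable ?M" if "i \<in> {1..m}" for i
  proof -
    have "(\<lambda>a. fst a i) \<in> measurable ?M P1"
      by (rule measurable_compose[OF measurable_fst measurable_component_singleton[OF that]])
    then show ?thesis by (subst measurable_cong_sets[OF refl assms(1)[symmetric]])
  qed
  have mY: "(\<lambda>a. snd a j) \<in> borel_measurable ?M" if "j \<in> {1..n}" for j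
  proof -
    have "(\<lambda>a. snd a j) \<in> measurable ?M P2"
      by (rule measurable_compose[OF measurable_snd measurable_component_singleton[OF that]])
    then show ?thesis by (subst measurable_cong_sets[OF refl assms(2)[symmetric]])
  qed
  have "(\<lambda>a. pmf (bernoulli_pmf (edge_prob n m (fst a (fst ij)) (snd a (snd ij)))) b)
      \<in> borel_measurable ?M" if "ij \<in> ?I" for ij b
  proof -
    from that have "fst ij \<in> {1..m}" "snd ij \<in> {1..n}" by auto
    note [measurable] = mX[OF this(1)] mY[OF this(2)]
    show ?thesis unfolding bern edge_prob_def by measurable
  qed
  then show "(\<lambda>a. emeasure (?K a) B) \<in> borel_measurable ?M"
    unfolding eq by (intro measurable_compose[OF _ measurable_ennreal] borel_measurable_sum borel_measurable_prod)
qed (auto simp: case_prod_beta measure_pmf.subprob_space_axioms)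

lemma
  assumes "real_distribution P1" "real_distribution P2"
  shows prob_space_random_intersection_graph: "prob_space (random_intersection_graph P1 P2 n m)"
    and sets_random_intersection_graph: "sets (random_intersection_graph P1 P2 n m) = UNIV"
proof -
  interpret P1: real_distribution P1 by fact
  interpret P2: real_distribution P2 by fact
  interpret X: prob_space "Pi\<^sub>M {1..m} (\<lambda>_. P1)"
    by (intro prob_space_PiM) (rule P1.prob_space_axioms)
  interpret Y: prob_space "Pi\<^sub>M {1..n} (\<lambda>_. P2)"
    by (intro prob_space_PiM) (rule P2.prob_space_axioms)
  interpret XY: pair_prob_space "Pi\<^sub>M {1..m} (\<lambda>_. P1)" "Pi\<^sub>M {1..n} (\<lambda>_. P2)" ..
  note K = measurable_bipartite_kernel[OF P1.events_eq_borel P2.events_eq_borel, of n m]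
  show "prob_space (random_intersection_graph P1 P2 n m)"
    unfolding random_intersection_graph_def
    by (rule XY.prob_space_bind[OF _ K]) (auto intro!: AE_I2 measure_pmf.prob_space_axioms simp: case_prod_beta)
  show "sets (random_intersection_graph P1 P2 n m) = UNIV"
    unfolding random_intersection_graph_def
    by (subst sets_bind_measurable[OF K XY.not_empty]) simp
qed

end

theory Submission
  imports Defs
begin

text \<open>
  We show convergence of generating functions on \<open>(0, 1)\<close>. Replace the degree of vertex 1 by the
  number of paths of length two from it in the bipartite graph. Given the vertex weights, this number is
  a sum of independent contributions of the attributes, so the generating function is an
  \<open>m\<close>-th power \<open>(1 - \<phi>) ^ m\<close> with
  \<open>\<phi> = E (p (X, Y\<^sub>1) * (1 - (\<Prod>v\<ge>2. 1 - (1 - s) * p (X, Y\<^sub>v))))\<close>.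
  For fixed \<open>x\<close> the product is a function of independent variables whose first two moments converge
  to \<open>exp (- (1 - s) * x * b\<^sub>1 / sqrt \<beta>)\<close> and its square, whence
  \<open>m * \<phi>\<close> converges in mean to the exponent of the limiting compound mixed Poisson law. The two counts differ
  only if some vertex is joined to vertex 1 through two attributes, and a union bound over pairs
  of attributes, truncated at 1 for each pair, is negligible by dominated convergence.
\<close>

section \<open>Weak convergence from generating functions\<close>

text \<open>The obstacle is that only first moments are available. A plain union bound for vertices
  reached through two attributes would involve second moments of both laws. It is therefore
  truncated twice: for a fixed pair of attributes, which leaves a bound linear in each attribute
  weight, and for a fixed weight \<open>y\<close> of vertex 1, where the remaining bound of order
  \<open>y^2\<close> need not be integrable. All attributes share the weights of the other vertices,
  so independence of the attributes must be used before these are averaged, and the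
  \<open>m\<close>-th power of a random variable remains. As |a^m - b^m| \<le> m |a - b| on [0, 1],
  convergence in mean of \<open>m\<close> times that variable is the right notion. The factor
  \<open>r + 1\<close> in the law of \<tau> is size-biasing. An attribute is joined to vertex 1 with
  probability nearly proportional to its weight, so seen from vertex 1 its weight follows
  \<open>P1\<close> biased by \<open>x\<close>. For Poisson weights, (r + 1) w_{r+1}(l) = l w_r(l);
  hence biasing the mixed Poisson law and removing one unit is the same as biasing the mixing
  weight.\<close>

lemma (in prob_space) expectation_power_truncation:
  fixes X :: "'a \<Rightarrow> nat" and s :: real
  assumes [measurable]: "X \<in> measurable M (count_space UNIV)" and s: "0 \<le> s" "s \<le> 1"
  shows "\<bar>expectation (\<lambda>\<omega>. s ^ X \<omega>) - (\<Sum>j\<le>r. s ^ j * prob {\<omega> \<in> space M. X \<omega> = j})\<bar> \<le> s ^ Suc r"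
proof -
  let ?A = "\<lambda>j. {\<omega> \<in> space M. X \<omega> = j}"
  let ?h = "\<lambda>\<omega>. \<Sum>j\<le>r. s ^ j * indicator (?A j) \<omega>"
  have int: "integrable M (\<lambda>\<omega>. s ^ X \<omega>)"
    by (rule integrable_const_bound[where B = 1]) (use s in \<open>auto simp: power_le_one\<close>)
  have int': "integrable M ?h"
    by (intro Bochner_Integration.integrable_sum integrable_mult_right) (auto simp: emeasure_eq_measure)
  have "(\<Sum>j\<le>r. s ^ j * prob (?A j)) = expectation ?h"
    by (subst Bochner_Integration.integral_sum) (auto simp: emeasure_eq_measure)
  then have "\<bar>expectation (\<lambda>\<omega>. s ^ X \<omega>) - (\<Sum>j\<le>r. s ^ j * prob (?A j))\<bar>
      = \<bar>expectation (\<lambda>\<omega>. s ^ X \<omega> - ?h \<omega>)\<bar>"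
    using int int' by simp
  also have "\<dots> \<le> expectation (\<lambda>\<omega>. \<bar>s ^ X \<omega> - ?h \<omega>\<bar>)"
    by (rule integral_abs_bound)
  \<comment> \<open>Up to \<open>r\<close> the sum reproduces the power exactly; beyond
    \<open>r\<close> it is 0 and the power itself is at most \<open>s ^ Suc r\<close>. The error is
    thus one order in \<open>s\<close> smaller than the last coefficient kept.\<close>
  also have "\<dots> \<le> expectation (\<lambda>\<omega>. s ^ Suc r)"
  proof (rule integral_mono)
    fix \<omega> assume w: "\<omega> \<in> space M"
    have "?h \<omega> = (\<Sum>j\<le>r. if j = X \<omega> then s ^ j else 0)"
      using w by (intro sum.cong) (auto simp: indicator_def)
    also have "\<dots> = (if X \<omega> \<le> r then s ^ X \<omega> else 0)" by (simp add: sum.delta)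
    finally have "?h \<omega> = (if X \<omega> \<le> r then s ^ X \<omega> else 0)" .
    then show "\<bar>s ^ X \<omega> - ?h \<omega>\<bar> \<le> s ^ Suc r"
      using s power_decreasing[of "Suc r" "X \<omega>" s] by (cases "X \<omega> \<le> r") (auto simp del: power_Suc)
  qed (use int int' in auto)
  finally show ?thesis by (simp add: prob_space)
qed

text \<open>Strong induction extracts the coefficient of \<open>s ^ r\<close>: the lower
  coefficients already converge, and division by \<open>s ^ r\<close> turns the truncation error
  \<open>s ^ Suc r\<close> into \<open>s\<close>, which may be chosen small after the tolerance
  \<open>e\<close>. Only generating functions near 0 matter, and no continuity theorem is
  invoked.\<close>

lemma tendsto_prob_if_pgf_tendsto:
  fixes X :: "nat \<Rightarrow> 'a \<Rightarrow> nat" and Z :: "'b \<Rightarrow> nat"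
  assumes M: "\<And>k. prob_space (M k)" and X: "\<And>k. X k \<in> measurable (M k) (count_space UNIV)"
    and N: "prob_space N" and Z: "Z \<in> measurable N (count_space UNIV)"
    and pgf: "\<And>s::real. 0 < s \<Longrightarrow> s < 1 \<Longrightarrow> (\<lambda>k. \<integral>\<omega>. s ^ X k \<omega> \<partial>M k) \<longlonglongrightarrow> (\<integral>\<omega>. s ^ Z \<omega> \<partial>N)"
  shows "(\<lambda>k. measure (M k) {\<omega> \<in> space (M k). X k \<omega> = r}) \<longlonglongrightarrow> measure N {\<omega> \<in> space N. Z \<omega> = r}"
proof (induction r rule: less_induct)
  case (less r)
  let ?p = "\<lambda>k j. measure (M k) {\<omega> \<in> space (M k). X k \<omega> = j}"
  let ?q = "\<lambda>j. measure N {\<omega> \<in> space N. Z \<omega> = j}"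
  show ?case
  proof (rule LIMSEQ_I)
    fix e :: real assume e: "0 < e"
    \<comment> \<open>After division by \<open>s ^ r\<close> the truncation errors of
      \<open>X k\<close> and \<open>Z\<close> add up to \<open>2 * s\<close>, hence to at most
      \<open>e / 2\<close>; the other half is spent on large \<open>k\<close>. The cap 1/2 keeps
      \<open>s\<close> below 1.\<close>
    define s where "s = min (1/2) (e/4)"
    have s: "0 < s" "s < 1" "2 * s \<le> e / 2" using e by (auto simp: s_def min_def)
    let ?E = "\<lambda>k. \<integral>\<omega>. s ^ X k \<omega> \<partial>M k"
    let ?F = "\<integral>\<omega>. s ^ Z \<omega> \<partial>N"
    have "(\<lambda>k. \<bar>?E k - ?F\<bar> + (\<Sum>j<r. s ^ j * \<bar>?p k j - ?q j\<bar>)) \<longlonglongrightarrow> \<bar>?F - ?F\<bar> + (\<Sum>j<r. s ^ j * \<bar>?q j - ?q j\<bar>)"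
      using s by (intro tendsto_intros pgf less) auto
    then have "(\<lambda>k. \<bar>?E k - ?F\<bar> + (\<Sum>j<r. s ^ j * \<bar>?p k j - ?q j\<bar>)) \<longlonglongrightarrow> 0" by simp
    moreover have "0 < s ^ r * (e / 2)" using s e by simp
    ultimately have "eventually (\<lambda>k. \<bar>?E k - ?F\<bar> + (\<Sum>j<r. s ^ j * \<bar>?p k j - ?q j\<bar>) < s ^ r * (e / 2)) sequentially"
      by (rule order_tendstoD(2))
    then obtain k0 where
      k0: "\<And>k. k \<ge> k0 \<Longrightarrow> \<bar>?E k - ?F\<bar> + (\<Sum>j<r. s ^ j * \<bar>?p k j - ?q j\<bar>) < s ^ r * (e / 2)"
      unfolding eventually_sequentially by blast
    show "\<exists>k0. \<forall>k\<ge>k0. norm (?p k r - ?q r) < e"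
    proof (intro exI allI impI)
      fix k assume k: "k \<ge> k0"
      have 1: "\<bar>?E k - ((\<Sum>j<r. s ^ j * ?p k j) + s ^ r * ?p k r)\<bar> \<le> s ^ Suc r"
        using prob_space.expectation_power_truncation[OF M X, of s k r] s
        by (simp add: lessThan_Suc_atMost[symmetric])
      have 2: "\<bar>?F - ((\<Sum>j<r. s ^ j * ?q j) + s ^ r * ?q r)\<bar> \<le> s ^ Suc r"
        using prob_space.expectation_power_truncation[OF N Z, of s r] s
        by (simp add: lessThan_Suc_atMost[symmetric])
      have 3: "\<bar>(\<Sum>j<r. s ^ j * ?p k j) - (\<Sum>j<r. s ^ j * ?q j)\<bar> \<le> (\<Sum>j<r. s ^ j * \<bar>?p k j - ?q j\<bar>)"
      proof -
        have "(\<Sum>j<r. s ^ j * ?p k j) - (\<Sum>j<r. s ^ j * ?q j) = (\<Sum>j<r. s ^ j * (?p k j - ?q j))"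
          by (simp add: sum_subtractf algebra_simps)
        then show ?thesis using s by (auto intro!: order_trans[OF sum_abs] simp: abs_mult)
      qed
      have "\<bar>s ^ r * ?p k r - s ^ r * ?q r\<bar> < s ^ r * (e / 2) + 2 * s ^ Suc r"
        using 1 2 3 k0[OF k] by linarith
      also have "\<dots> = s ^ r * (e / 2 + 2 * s)" by (simp add: algebra_simps)
      also have "\<dots> \<le> s ^ r * e" using s by (intro mult_left_mono) auto
      finally have "s ^ r * \<bar>?p k r - ?q r\<bar> < s ^ r * e"
        using s by (simp add: right_diff_distrib[symmetric] abs_mult)
      then show "norm (?p k r - ?q r) < e" using s by simp
    qed
  qed
qed

lemma (in prob_space) cdf_distr_of_nat:
  fixes X :: "'a \<Rightarrow> nat"
  assumes [measurable]: "X \<in> measurable M (count_space UNIV)"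
  shows "cdf (distr M borel (\<lambda>\<omega>. real (X \<omega>))) x = (\<Sum>j | real j \<le> x. prob {\<omega> \<in> space M. X \<omega> = j})"
proof -
  have fin: "finite {j. real j \<le> x}"
    by (rule finite_subset[of _ "{..nat \<lfloor>x\<rfloor>}"]) (auto simp: le_nat_floor)
  have "cdf (distr M borel (\<lambda>\<omega>. real (X \<omega>))) x = prob {\<omega> \<in> space M. real (X \<omega>) \<le> x}"
    unfolding cdf_def by (subst measure_distr) (auto intro!: arg_cong[where f = prob])
  also have "{\<omega> \<in> space M. real (X \<omega>) \<le> x} = (\<Union>j\<in>{j. real j \<le> x}. {\<omega> \<in> space M. X \<omega> = j})"
    by auto
  also have "prob \<dots> = (\<Sum>j | real j \<le> x. prob {\<omega> \<in> space M. X \<omega> = j})"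
    by (rule finite_measure_finite_Union[OF fin]) (auto simp: disjoint_family_on_def)
  finally show ?thesis .
qed

text \<open>At each point the distribution function of a law on the naturals is a finite sum of
  point masses. It therefore converges everywhere, not just at continuity points, and tightness need
  not be discussed.\<close>

lemma weak_conv_m_if_pgf_tendsto:
  fixes X :: "nat \<Rightarrow> 'a \<Rightarrow> nat" and Z :: "'b \<Rightarrow> nat"
  assumes M: "\<And>k. prob_space (M k)" and X: "\<And>k. X k \<in> measurable (M k) (count_space UNIV)"
    and N: "prob_space N" and Z: "Z \<in> measurable N (count_space UNIV)"
    and pgf: "\<And>s::real. 0 < s \<Longrightarrow> s < 1 \<Longrightarrow> (\<lambda>k. \<integral>\<omega>. s ^ X k \<omega> \<partial>M k) \<longlonglongrightarrow> (\<integral>\<omega>. s ^ Z \<omega> \<partial>N)"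
  shows "weak_conv_m (\<lambda>k. distr (M k) borel (\<lambda>\<omega>. real (X k \<omega>))) (distr N borel (\<lambda>\<omega>. real (Z \<omega>)))"
  unfolding weak_conv_m_def weak_conv_def
  using tendsto_prob_if_pgf_tendsto[of M X, OF assms]
  by (auto simp: prob_space.cdf_distr_of_nat[OF M X] prob_space.cdf_distr_of_nat[OF N Z]
      intro!: tendsto_sum)

section \<open>The bipartite graph with fixed weights\<close>

text \<open>Fubini for finitely supported laws, where integrability is automatic. It serves to
  condition on the edges at vertex 1.\<close>

lemma expectation_pair_pmf:
  fixes f :: "'a \<times> 'b \<Rightarrow> real"
  assumes "finite (set_pmf p)" "finite (set_pmf q)"
  shows "measure_pmf.expectation (pair_pmf p q) f =
    measure_pmf.expectation p (\<lambda>a. measure_pmf.expectation q (\<lambda>b. f (a, b)))"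
proof -
  have "measure_pmf.expectation (pair_pmf p q) f =
      (\<Sum>a\<in>set_pmf p. pmf p a *\<^sub>R measure_pmf.expectation (map_pmf (Pair a) q) f)"
    unfolding pair_pmf_def map_pmf_def[symmetric] using assms by (intro pmf_expectation_bind) auto
  also have "\<dots> = measure_pmf.expectation p (\<lambda>a. measure_pmf.expectation q (\<lambda>b. f (a, b)))"
    using assms by (subst integral_measure_pmf[of "set_pmf p"]) auto
  finally show ?thesis .
qed

lemma finite_set_Pi_pmf_bool:
  "finite A \<Longrightarrow> finite (set_pmf (Pi_pmf A dflt (p :: _ \<Rightarrow> bool pmf)))"
  by (rule finite_subset[OF set_Pi_pmf_subset']) auto

lemma prob_Pi_pmf_bernoulli_all:
  assumes "finite A" "S \<subseteq> A" "\<And>x. x \<in> S \<Longrightarrow> 0 \<le> q x \<and> q x \<le> 1"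
  shows "measure_pmf.prob (Pi_pmf A d (\<lambda>x. bernoulli_pmf (q x))) {H. \<forall>x\<in>S. H x} = (\<Prod>x\<in>S. q x)"
proof -
  let ?B = "\<lambda>x. if x \<in> S then {True} else UNIV"
  have "{H. \<forall>x\<in>S. H x} = Pi A ?B" using assms(2) by (auto simp: Pi_def split: if_splits)
  then have "measure_pmf.prob (Pi_pmf A d (\<lambda>x. bernoulli_pmf (q x))) {H. \<forall>x\<in>S. H x}
      = (\<Prod>x\<in>A. measure_pmf.prob (bernoulli_pmf (q x)) (?B x))"
    using assms(1) by (simp add: measure_Pi_pmf_Pi)
  also have "\<dots> = (\<Prod>x\<in>A. if x \<in> S then q x else 1)"
    using assms(3) by (intro prod.cong) (auto simp: measure_pmf_single)
  also have "\<dots> = (\<Prod>x\<in>S. q x)"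
    using assms(1,2) by (simp add: prod.If_cases Int_absorb1)
  finally show ?thesis .
qed

text \<open>
  \<open>path_weight\<close> is \<open>s\<close> to the number of paths of length two from vertex 1; unlike
  \<open>s\<close> to the degree, it factorises over the attributes.
\<close>

definition path_weight :: "real \<Rightarrow> nat \<Rightarrow> nat \<Rightarrow> (nat \<times> nat \<Rightarrow> bool) \<Rightarrow> real" where
  "path_weight s n m H = (\<Prod>v\<in>{2..n}. \<Prod>i\<in>{1..m}. if H (i, 1) \<and> H (i, v) then s else 1)"

lemma prod_Times_singleton: "(\<Prod>x\<in>I \<times> {a}. g x) = (\<Prod>i\<in>I. g (i, a))"
  by (rule prod.reindex_bij_witness[of _ "\<lambda>i. (i, a)" fst]) auto

text \<open>Condition on the edges at vertex 1 (the set \<open>A\<close>). If attribute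
  \<open>i\<close> is joined to 1, its independent edges to the other vertices contribute the
  product \<open>R i\<close>, otherwise they contribute 1. Averaging over the edge
  \<open>(i, 1)\<close> gives \<open>1 - q (i, 1) * (1 - R i)\<close>, and distinct attributes use
  disjoint sets of edges.\<close>

lemma expectation_path_weight:
  fixes q :: "nat \<times> nat \<Rightarrow> real"
  assumes n: "1 \<le> n" and q: "\<And>x. x \<in> {1..m} \<times> {1..n} \<Longrightarrow> 0 \<le> q x \<and> q x \<le> 1"
    and s: "0 \<le> s" "s \<le> 1"
  shows "measure_pmf.expectation (Pi_pmf ({1..m} \<times> {1..n}) False (\<lambda>x. bernoulli_pmf (q x))) (path_weight s n m) =
    (\<Prod>i\<in>{1..m}. 1 - q (i, 1) * (1 - (\<Prod>v\<in>{2..n}. 1 - (1 - s) * q (i, v))))"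
proof -
  define A where "A = {1..m} \<times> {1::nat}"
  define B where "B = {1..m} \<times> {2..n}"
  let ?P = "\<lambda>A. Pi_pmf A False (\<lambda>x. bernoulli_pmf (q x))"
  define R where "R = (\<lambda>i. \<Prod>v\<in>{2..n}. 1 - (1 - s) * q (i, v))"
  have fin: "finite A" "finite B" by (auto simp: A_def B_def)
  have AB: "{1..m} \<times> {1..n} = A \<union> B" "A \<inter> B = {}" using n by (auto simp: A_def B_def)
  have qA: "0 \<le> q x \<and> q x \<le> 1" if "x \<in> A" for x using q[of x] that unfolding AB(1) by blast
  have qB: "0 \<le> q x \<and> q x \<le> 1" if "x \<in> B" for x using q[of x] that unfolding AB(1) by blast
  \<comment> \<open>\<open>Pi_pmf_union\<close> presents a configuration as \<open>f\<close> on
    \<open>A\<close> glued to \<open>g\<close> elsewhere. Edges at 1 are read from \<open>f\<close>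
    and the edges in \<open>B\<close>, which lie outside \<open>A\<close>, from
    \<open>g\<close>.\<close>
  have pw: "path_weight s n m (\<lambda>x. if x \<in> A then f x else g x) =
      (\<Prod>x\<in>B. if f (fst x, 1) \<and> g x then s else 1)" for f g
  proof -
    have "path_weight s n m (\<lambda>x. if x \<in> A then f x else g x) =
        (\<Prod>i\<in>{1..m}. \<Prod>v\<in>{2..n}. if f (i, 1) \<and> g (i, v) then s else 1)"
      unfolding path_weight_def by (subst prod.swap) (auto intro!: prod.cong simp: A_def)
    also have "\<dots> = (\<Prod>x\<in>B. if f (fst x, 1) \<and> g x then s else 1)"
      unfolding B_def by (subst prod.cartesian_product) (auto intro!: prod.cong)
    finally show ?thesis .
  qed
  have inner: "measure_pmf.expectation (?P B) (\<lambda>g. \<Prod>x\<in>B. if f (fst x, 1) \<and> g x then s else 1)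
      = (\<Prod>x\<in>A. if f x then R (fst x) else 1)" for f
  proof -
    have "measure_pmf.expectation (?P B) (\<lambda>g. \<Prod>x\<in>B. if f (fst x, 1) \<and> g x then s else 1)
        = (\<Prod>x\<in>B. measure_pmf.expectation (bernoulli_pmf (q x)) (\<lambda>b. if f (fst x, 1) \<and> b then s else 1))"
      using s fin by (intro expectation_prod_Pi_pmf[where f = "\<lambda>x b. if f (fst x, 1) \<and> b then s else 1"])
        (auto intro!: integrable_measure_pmf_finite)
    also have "\<dots> = (\<Prod>x\<in>B. if f (fst x, 1) then 1 - (1 - s) * q x else 1)"
      using qB by (intro prod.cong) (auto simp: algebra_simps)
    also have "\<dots> = (\<Prod>i\<in>{1..m}. \<Prod>v\<in>{2..n}. if f (i, 1) then 1 - (1 - s) * q (i, v) else 1)"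
      unfolding B_def by (subst prod.cartesian_product) (auto intro!: prod.cong)
    also have "\<dots> = (\<Prod>i\<in>{1..m}. if f (i, 1) then R i else 1)"
      by (intro prod.cong) (auto simp: R_def)
    also have "\<dots> = (\<Prod>x\<in>A. if f x then R (fst x) else 1)"
      unfolding A_def by (auto simp: prod_Times_singleton intro!: prod.cong)
    finally show ?thesis .
  qed
  have R0: "0 \<le> R (fst x)" if "x \<in> A" for x
    unfolding R_def using qB s that
  proof (intro prod_nonneg)
    fix v assume "v \<in> {2..n}"
    then have "(fst x, v) \<in> B" using that by (auto simp: A_def B_def)
    then have "(1 - s) * q (fst x, v) \<le> 1" using qB s by (intro mult_le_one) auto
    then show "0 \<le> 1 - (1 - s) * q (fst x, v)" by simp
  qed
  have "measure_pmf.expectation (?P ({1..m} \<times> {1..n})) (path_weight s n m) =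
     measure_pmf.expectation (pair_pmf (?P A) (?P B)) (\<lambda>(f, g). \<Prod>x\<in>B. if f (fst x, 1) \<and> g x then s else 1)"
    unfolding AB(1) Pi_pmf_union[OF fin AB(2)] by (simp add: pw case_prod_unfold)
  also have "\<dots> = measure_pmf.expectation (?P A) (\<lambda>f. \<Prod>x\<in>A. if f x then R (fst x) else 1)"
    using fin by (simp add: expectation_pair_pmf finite_set_Pi_pmf_bool inner del: One_nat_def)
  also have "\<dots> = (\<Prod>x\<in>A. measure_pmf.expectation (bernoulli_pmf (q x)) (\<lambda>b. if b then R (fst x) else 1))"
    using R0 fin by (intro expectation_prod_Pi_pmf[where f = "\<lambda>x b. if b then R (fst x) else 1"])
      (auto intro!: integrable_measure_pmf_finite)
  also have "\<dots> = (\<Prod>x\<in>A. 1 - q x * (1 - R (fst x)))"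
    using qA by (intro prod.cong) (auto simp: algebra_simps)
  also have "\<dots> = (\<Prod>i\<in>{1..m}. 1 - q (i, 1) * (1 - R i))"
    unfolding A_def by (auto simp: prod_Times_singleton intro!: prod.cong)
  finally show ?thesis by (simp add: R_def)
qed

lemma power_vertex_degree:
  fixes s :: real
  assumes "1 \<le> n"
  shows "s ^ vertex_degree (intersection_graph n m H) 1 =
    (\<Prod>v\<in>{2..n}. if \<exists>i\<in>{1..m}. H (i, 1) \<and> H (i, v) then s else 1)"
proof -
  have "{u. (1, u) \<in> intersection_graph n m H} = {v \<in> {2..n}. \<exists>i\<in>{1..m}. H (i, 1) \<and> H (i, v)}"
    using assms by (auto simp: intersection_graph_def)
  then show ?thesis by (simp add: vertex_degree_def prod.If_cases Int_def)
qed

text \<open>Both sides are products over the vertices \<open>v\<close>. They can differ only at a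
  \<open>v\<close> sharing two attributes with vertex 1, where the path count contributes
  \<open>s\<close> at least twice and the degree once.\<close>

lemma path_weight_eq_power_degree:
  assumes "1 \<le> n"
    and "\<And>i i' v. \<lbrakk>i \<in> {1..m}; i' \<in> {1..m}; i \<noteq> i'; v \<in> {2..n}; H (i, 1); H (i', 1); H (i, v)\<rbrakk> \<Longrightarrow> \<not> H (i', v)"
  shows "path_weight s n m H = s ^ vertex_degree (intersection_graph n m H) 1"
  unfolding path_weight_def power_vertex_degree[OF assms(1)]
proof (intro prod.cong refl)
  fix v assume v: "v \<in> {2..n}"
  show "(\<Prod>i\<in>{1..m}. if H (i, 1) \<and> H (i, v) then s else 1) =
      (if \<exists>i\<in>{1..m}. H (i, 1) \<and> H (i, v) then s else 1)"
  proof (cases "\<exists>i\<in>{1..m}. H (i, 1) \<and> H (i, v)")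
    case True
    then obtain j where j: "j \<in> {1..m}" "H (j, 1)" "H (j, v)" by auto
    have "H (i, 1) \<and> H (i, v) \<longleftrightarrow> i = j" if "i \<in> {1..m}" for i
      using assms(2)[of j i v] j v that by blast
    then have "(\<Prod>i\<in>{1..m}. if H (i, 1) \<and> H (i, v) then s else 1) = (\<Prod>i\<in>{1..m}. if i = j then s else 1)"
      by (intro prod.cong) simp_all
    then show ?thesis using j by (auto simp: prod.delta)
  qed (auto intro!: prod.neutral)
qed

text \<open>Both quantities lie in [0, 1] and agree off \<open>bad\<close>, so the difference of
  means is at most the probability of \<open>bad\<close>. For a pair of attributes this probability
  has two bounds: forget the second common vertex altogether, or sum over it. The minimum of the two
  is the truncated term, with \<open>q (i, 1) * q (i', 1)\<close> kept outside.\<close>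

lemma expectation_power_degree_approx:
  fixes q :: "nat \<times> nat \<Rightarrow> real"
  assumes n: "1 \<le> n" and q: "\<And>x. x \<in> {1..m} \<times> {1..n} \<Longrightarrow> 0 \<le> q x \<and> q x \<le> 1"
    and s: "0 \<le> s" "s \<le> 1"
  defines "P \<equiv> Pi_pmf ({1..m} \<times> {1..n}) False (\<lambda>x. bernoulli_pmf (q x))"
  shows "\<bar>measure_pmf.expectation P (\<lambda>H. s ^ vertex_degree (intersection_graph n m H) 1) -
      measure_pmf.expectation P (path_weight s n m)\<bar> \<le>
    (\<Sum>i\<in>{1..m}. \<Sum>i'\<in>{1..m} - {i}. q (i, 1) * q (i', 1) * min 1 (\<Sum>v\<in>{2..n}. q (i, v) * q (i', v)))"
proof -
  define E where "E = (\<lambda>i i' :: nat. {H :: nat \<times> nat \<Rightarrow> bool. H (i, 1) \<and> H (i', 1) \<and> (\<exists>v\<in>{2..n}. H (i, v) \<and> H (i', v))})"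
  define bad where "bad = (\<Union>i\<in>{1..m}. \<Union>i'\<in>{1..m} - {i}. E i i')"
  let ?d = "\<lambda>H. s ^ vertex_degree (intersection_graph n m H) 1"
  have fin: "finite (set_pmf P)" unfolding P_def by (intro finite_set_Pi_pmf_bool) auto
  have pw01: "0 \<le> path_weight s n m H" "path_weight s n m H \<le> 1" for H
    unfolding path_weight_def using s by (auto intro!: prod_nonneg prod_le_1)
  have prob: "measure_pmf.prob P {H. \<forall>x\<in>S. H x} = (\<Prod>x\<in>S. q x)" if "S \<subseteq> {1..m} \<times> {1..n}" for S
    unfolding P_def using that q by (intro prob_Pi_pmf_bernoulli_all) auto
  have E: "measure_pmf.prob P (E i i') \<le> q (i, 1) * q (i', 1) * min 1 (\<Sum>v\<in>{2..n}. q (i, v) * q (i', v))"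
    if i: "i \<in> {1..m}" "i' \<in> {1..m}" "i \<noteq> i'" for i i'
  proof -
    have "measure_pmf.prob P (E i i') \<le> measure_pmf.prob P {H. \<forall>x\<in>{(i, 1), (i', 1)}. H x}"
      by (intro measure_pmf.finite_measure_mono) (auto simp: E_def)
    also have "\<dots> = q (i, 1) * q (i', 1)" using i n by (subst prob) auto
    finally have 1: "measure_pmf.prob P (E i i') \<le> q (i, 1) * q (i', 1)" .
    have "E i i' \<subseteq> (\<Union>v\<in>{2..n}. {H. \<forall>x\<in>{(i, 1), (i', 1), (i, v), (i', v)}. H x})"
      by (auto simp: E_def)
    then have "measure_pmf.prob P (E i i') \<le>
        measure_pmf.prob P (\<Union>v\<in>{2..n}. {H. \<forall>x\<in>{(i, 1), (i', 1), (i, v), (i', v)}. H x})"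
      by (intro measure_pmf.finite_measure_mono) auto
    also have "\<dots> \<le> (\<Sum>v\<in>{2..n}. measure_pmf.prob P {H. \<forall>x\<in>{(i, 1), (i', 1), (i, v), (i', v)}. H x})"
      by (intro measure_pmf.finite_measure_subadditive_finite) auto
    \<comment> \<open>The four edges are distinct because \<open>i \<noteq> i'\<close> and
      \<open>v\<close> is not 1, so their probabilities multiply.\<close>
    also have "\<dots> = (\<Sum>v\<in>{2..n}. q (i, 1) * q (i', 1) * (q (i, v) * q (i', v)))"
      using i n by (intro sum.cong refl, subst prob) auto
    also have "\<dots> = q (i, 1) * q (i', 1) * (\<Sum>v\<in>{2..n}. q (i, v) * q (i', v))"
      by (simp add: sum_distrib_left)
    finally show ?thesis using 1 by (auto simp: min_def)
  qed
  have "\<bar>measure_pmf.expectation P ?d - measure_pmf.expectation P (path_weight s n m)\<bar>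
      = \<bar>measure_pmf.expectation P (\<lambda>H. ?d H - path_weight s n m H)\<bar>"
    using fin by (simp add: integrable_measure_pmf_finite)
  also have "\<dots> \<le> measure_pmf.expectation P (\<lambda>H. \<bar>?d H - path_weight s n m H\<bar>)"
    by (rule integral_abs_bound)
  also have "\<dots> \<le> measure_pmf.expectation P (indicator bad)"
  proof (rule integral_mono)
    fix H
    show "\<bar>?d H - path_weight s n m H\<bar> \<le> indicator bad H"
    proof (cases "H \<in> bad")
      case True
      have "0 \<le> ?d H" "?d H \<le> 1" using s by (auto simp: power_le_one)
      moreover have "indicator bad H = (1::real)" using True by (rule indicator_simps(1))
      ultimately show ?thesis using pw01[of H] by linarith
    next
      case False
      have "path_weight s n m H = ?d H"
      proof (rule path_weight_eq_power_degree[OF n])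
        fix i i' v assume "i \<in> {1..m}" "i' \<in> {1..m}" "i \<noteq> i'" "v \<in> {2..n}" "H (i, 1)" "H (i', 1)" "H (i, v)"
        with False show "\<not> H (i', v)" unfolding bad_def E_def by blast
      qed
      moreover have "indicator bad H = (0::real)" using False by (rule indicator_simps(2))
      ultimately show ?thesis by simp
    qed
  qed (simp_all only: integrable_measure_pmf_finite[OF fin])
  also have "\<dots> = measure_pmf.prob P bad" by simp
  also have "\<dots> \<le> (\<Sum>i\<in>{1..m}. measure_pmf.prob P (\<Union>i'\<in>{1..m} - {i}. E i i'))"
    unfolding bad_def by (intro measure_pmf.finite_measure_subadditive_finite) auto
  also have "\<dots> \<le> (\<Sum>i\<in>{1..m}. \<Sum>i'\<in>{1..m} - {i}. measure_pmf.prob P (E i i'))"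
    by (intro sum_mono measure_pmf.finite_measure_subadditive_finite) auto
  also have "\<dots> \<le> (\<Sum>i\<in>{1..m}. \<Sum>i'\<in>{1..m} - {i}. q (i, 1) * q (i', 1) * min 1 (\<Sum>v\<in>{2..n}. q (i, v) * q (i', v)))"
    by (intro sum_mono E) auto
  finally show ?thesis .
qed

section \<open>Integration over the weights\<close>

lemma integral_swap_bounded:
  fixes f :: "'a \<Rightarrow> 'b \<Rightarrow> real"
  assumes "prob_space A" "prob_space B"
    and f: "(\<lambda>(x, y). f x y) \<in> borel_measurable (A \<Otimes>\<^sub>M B)" and bound: "\<And>x y. \<bar>f x y\<bar> \<le> C"
  shows "(\<integral>x. \<integral>y. f x y \<partial>B \<partial>A) = (\<integral>y. \<integral>x. f x y \<partial>A \<partial>B)"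
    and "(\<integral>z. f (fst z) (snd z) \<partial>(A \<Otimes>\<^sub>M B)) = (\<integral>y. \<integral>x. f x y \<partial>A \<partial>B)"
proof -
  interpret A: prob_space A by fact
  interpret B: prob_space B by fact
  interpret AB: pair_prob_space A B ..
  have int: "integrable (A \<Otimes>\<^sub>M B) (\<lambda>(x, y). f x y)"
    by (rule AB.integrable_const_bound[where B = C]) (use f bound in auto)
  show "(\<integral>x. \<integral>y. f x y \<partial>B \<partial>A) = (\<integral>y. \<integral>x. f x y \<partial>A \<partial>B)"
    using AB.Fubini_integral[OF int] by simp
  show "(\<integral>z. f (fst z) (snd z) \<partial>(A \<Otimes>\<^sub>M B)) = (\<integral>y. \<integral>x. f x y \<partial>A \<partial>B)"
    using AB.integral_snd[OF int] by (simp add: case_prod_unfold)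
qed

lemma integral_PiM_component:
  fixes f :: "'a \<Rightarrow> real"
  assumes "\<And>i. i \<in> I \<Longrightarrow> prob_space (M i)" "i \<in> I" "f \<in> borel_measurable (M i)"
  shows "(\<integral>X. f (X i) \<partial>Pi\<^sub>M I M) = (\<integral>x. f x \<partial>M i)"
  using assms
  by (subst distr_PiM_component[symmetric, OF assms(1,2)])
    (auto simp: integral_distr intro!: measurable_component_singleton)

text \<open>Splitting off coordinate \<open>i\<close> and integrating it out leaves a function of
  coordinate \<open>j\<close> alone, to which the one-coordinate rule applies.\<close>

lemma integral_PiM_two_components:
  fixes f :: "'a \<Rightarrow> 'a \<Rightarrow> real"
  assumes P: "prob_space P" and I: "finite I" "i \<in> I" "j \<in> I" "i \<noteq> j"
    and f: "(\<lambda>(x, y). f x y) \<in> borel_measurable (P \<Otimes>\<^sub>M P)" and bound: "\<And>x y. \<bar>f x y\<bar> \<le> C"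
  shows "(\<integral>X. f (X i) (X j) \<partial>Pi\<^sub>M I (\<lambda>_. P)) = (\<integral>y. \<integral>x. f x y \<partial>P \<partial>P)"
proof -
  interpret P: prob_space P by fact
  interpret product_sigma_finite "\<lambda>_. P" ..
  interpret PI: prob_space "Pi\<^sub>M I (\<lambda>_. P)" by (rule prob_space_PiM) (rule P)
  define J where "J = I - {i}"
  have J: "I = insert i J" "finite J" "i \<notin> J" "j \<in> J" using I by (auto simp: J_def)
  have m: "(\<lambda>X. f (X i) (X j)) \<in> borel_measurable (Pi\<^sub>M I (\<lambda>_. P))"
    using measurable_compose[OF measurable_Pair[OF measurable_component_singleton[OF I(2)] measurable_component_singleton[OF I(3)]] f]
    by simp
  have int: "integrable (Pi\<^sub>M I (\<lambda>_. P)) (\<lambda>X. f (X i) (X j))"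
    by (rule PI.integrable_const_bound[where B = C]) (use m bound in auto)
  have "(\<integral>X. f (X i) (X j) \<partial>Pi\<^sub>M I (\<lambda>_. P)) = (\<integral>X. (\<integral>x. f x (X j) \<partial>P) \<partial>Pi\<^sub>M J (\<lambda>_. P))"
    using product_integral_insert[OF J(2,3) int[unfolded J(1)]] I(4) by (simp add: J(1))
  also have "\<dots> = (\<integral>y. \<integral>x. f x y \<partial>P \<partial>P)"
  proof (rule integral_PiM_component[where f = "\<lambda>y. \<integral>x. f x y \<partial>P"])
    have "(\<lambda>(y, x). f x y) \<in> borel_measurable (P \<Otimes>\<^sub>M P)"
      using measurable_compose[OF measurable_pair_swap' f] by (simp add: case_prod_unfold)
    then show "(\<lambda>y. \<integral>x. f x y \<partial>P) \<in> borel_measurable P"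
      by (intro P.borel_measurable_lebesgue_integral)
  qed (use P J in auto)
  finally show ?thesis .
qed

text \<open>Jensen's inequality for the concave function \<open>min 1\<close>. It lets a truncation
  survive an average: over the vertex weights inside the pair bound, and over all weights but that
  of vertex 1 outside.\<close>

lemma integral_min_one_le:
  fixes f :: "'a \<Rightarrow> real"
  assumes "prob_space M" "integrable M f"
  shows "(\<integral>x. min 1 (f x) \<partial>M) \<le> min 1 (\<integral>x. f x \<partial>M)"
proof -
  interpret prob_space M by fact
  have i: "integrable M (\<lambda>x. min 1 (f x))" using assms by (intro integrable_min) auto
  have "(\<integral>x. min 1 (f x) \<partial>M) \<le> (\<integral>x. 1 \<partial>M)" by (intro integral_mono i) auto
  moreover have "(\<integral>x. min 1 (f x) \<partial>M) \<le> (\<integral>x. f x \<partial>M)" by (intro integral_mono i assms) auto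
  ultimately show ?thesis by (simp add: prob_space)
qed

lemma (in prob_space) abs_integral_le:
  fixes f :: "'a \<Rightarrow> real"
  assumes "\<And>x. \<bar>f x\<bar> \<le> C"
  shows "\<bar>expectation f\<bar> \<le> C"
proof -
  have "0 \<le> C" using assms[of undefined] by linarith
  then have "expectation (\<lambda>x. \<bar>f x\<bar>) \<le> expectation (\<lambda>x. C)"
    by (intro integral_mono' assms) auto
  then show ?thesis by (intro order_trans[OF integral_abs_bound]) (simp add: prob_space)
qed

lemma (in prob_space) integrable_bounded:
  fixes f :: "'a \<Rightarrow> real"
  assumes "f \<in> borel_measurable M" "\<And>x. \<bar>f x\<bar> \<le> C"
  shows "integrable M f"
  using assms by (intro integrable_const_bound[where B = C]) auto

locale two_real_distributions = P1: real_distribution P1 + P2: real_distribution P2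
  for P1 P2 :: "real measure"
begin

text \<open>
  Below, \<open>g\<close> stands for the truncated edge probability and \<open>z\<close> for the weights of
  the vertices other than 1.
\<close>

context
  fixes g :: "real \<Rightarrow> real \<Rightarrow> real"
  assumes g: "(\<lambda>(x, y). g x y) \<in> borel_measurable (borel \<Otimes>\<^sub>M borel)"
    and g01: "\<And>x y. 0 \<le> g x y" "\<And>x y. g x y \<le> 1"
begin

lemma g_measurable:
  "\<lbrakk>f \<in> borel_measurable M; h \<in> borel_measurable M\<rbrakk> \<Longrightarrow> (\<lambda>w. g (f w) (h w)) \<in> borel_measurable M"
  using measurable_compose[OF measurable_Pair g] by simp

text \<open>Only two coordinates of \<open>X\<close> occur, so the attribute average is a double
  integral over \<open>P1\<close>. With the average over \<open>z\<close> moved innermost, Jensen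
  puts the mean inside \<open>min 1\<close>, and each vertex contributes the same one-dimensional
  integral.\<close>

lemma integral_two_paths_le:
  fixes n :: nat and I :: "nat set"
  assumes I: "finite I" "i \<in> I" "i' \<in> I" "i \<noteq> i'"
  shows "(\<integral>z. \<integral>X. g (X i) y * g (X i') y * min 1 (\<Sum>v\<in>{2..n}. g (X i) (z v) * g (X i') (z v))
      \<partial>Pi\<^sub>M I (\<lambda>_. P1) \<partial>Pi\<^sub>M {2..n} (\<lambda>_. P2)) \<le>
    (\<integral>x'. \<integral>x. g x y * g x' y * min 1 (real n * (\<integral>w. g x w * g x' w \<partial>P2)) \<partial>P1 \<partial>P1)"
proof -
  note [measurable (raw)] = g_measurable
  let ?Z = "Pi\<^sub>M {2..n} (\<lambda>_. P2)"
  let ?S = "\<lambda>x x' z. \<Sum>v\<in>{2..n}. g x (z v) * g x' (z v)"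
  let ?b = "\<lambda>x x' z. g x y * g x' y * min 1 (?S x x' z)"
  interpret Z: prob_space ?Z by (rule prob_space_PiM) (rule P2.prob_space_axioms)
  have S0: "0 \<le> ?S x x' z" for x x' z by (intro sum_nonneg mult_nonneg_nonneg g01)
  have b0: "0 \<le> ?b x x' z" for x x' z
    by (rule mult_nonneg_nonneg[OF mult_nonneg_nonneg[OF g01(1) g01(1)] min.boundedI[OF zero_le_one S0]])
  have ggabs: "\<bar>g x w * g x' w\<bar> \<le> 1" for x x' w
    using g01 by (simp add: mult_le_one)
  have gg1: "g x y * g x' y \<le> 1" for x x' by (intro mult_le_one g01)
  have b1: "?b x x' z \<le> 1" for x x' z
    by (rule mult_le_one[OF gg1 min.boundedI[OF zero_le_one S0] min.cobounded1])
  have babs: "\<bar>?b x x' z\<bar> \<le> 1" for x x' z using b0[of x x' z] b1[of x x' z] by linarith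
  have int_le: "(\<integral>z. ?b x x' z \<partial>?Z) \<le> g x y * g x' y * min 1 (real n * (\<integral>w. g x w * g x' w \<partial>P2))" for x x'
  proof -
    have comp: "(\<integral>z. g x (z v) * g x' (z v) \<partial>?Z) = (\<integral>w. g x w * g x' w \<partial>P2)"
      and comp_int: "integrable ?Z (\<lambda>z. g x (z v) * g x' (z v))" if "v \<in> {2..n}" for v
    proof -
      show "(\<integral>z. g x (z v) * g x' (z v) \<partial>?Z) = (\<integral>w. g x w * g x' w \<partial>P2)"
        using that by (intro integral_PiM_component[where f = "\<lambda>w. g x w * g x' w"])
          (auto intro: P2.prob_space_axioms)
      show "integrable ?Z (\<lambda>z. g x (z v) * g x' (z v))"
        using that ggabs by (intro Z.integrable_const_bound[where B = 1]) auto
    qed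
    have k0: "0 \<le> (\<integral>w. g x w * g x' w \<partial>P2)" using g01 by simp
    have "(\<integral>z. ?b x x' z \<partial>?Z) = g x y * g x' y * (\<integral>z. min 1 (?S x x' z) \<partial>?Z)" by simp
    also have "\<dots> \<le> g x y * g x' y * min 1 (\<integral>z. ?S x x' z \<partial>?Z)"
      using comp_int by (intro mult_left_mono integral_min_one_le Z.prob_space_axioms mult_nonneg_nonneg g01) auto
    also have "(\<integral>z. ?S x x' z \<partial>?Z) = real (card {2..n}) * (\<integral>w. g x w * g x' w \<partial>P2)"
      using comp comp_int by (subst Bochner_Integration.integral_sum) auto
    \<comment> \<open>The number of vertices in \<open>{2..n}\<close> is rounded up to
      \<open>n\<close>.\<close>
    also have "g x y * g x' y * min 1 \<dots> \<le> g x y * g x' y * min 1 (real n * (\<integral>w. g x w * g x' w \<partial>P2))"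
      using k0 g01 by (intro mult_left_mono min.mono mult_right_mono mult_nonneg_nonneg) auto
    finally show ?thesis .
  qed
  have meas_b: "(\<lambda>(z, x). ?b x x' z) \<in> borel_measurable (?Z \<Otimes>\<^sub>M P1)" for x' by measurable
  have meas_ib: "(\<lambda>(z, x'). \<integral>x. ?b x x' z \<partial>P1) \<in> borel_measurable (?Z \<Otimes>\<^sub>M P1)"
    by measurable
  have meas_t: "(\<lambda>(x', x). g x y * g x' y * min 1 (real n * (\<integral>w. g x w * g x' w \<partial>P2))) \<in> borel_measurable (P1 \<Otimes>\<^sub>M P1)"
    by measurable
  have tabs: "\<bar>g x y * g x' y * min 1 (real n * (\<integral>w. g x w * g x' w \<partial>P2))\<bar> \<le> 1" for x x'
  proof -
    have "0 \<le> (\<integral>w. g x w * g x' w \<partial>P2)" using g01 by simp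
    then have "\<bar>min 1 (real n * (\<integral>w. g x w * g x' w \<partial>P2))\<bar> \<le> 1" by simp
    then show ?thesis using ggabs[of x y x'] unfolding abs_mult[of "g x y * g x' y"] by (intro mult_le_one) auto
  qed
  have iabs: "\<bar>\<integral>x. ?b x x' z \<partial>P1\<bar> \<le> 1" for x' z
    by (intro P1.abs_integral_le babs)
  have "(\<integral>z. \<integral>X. ?b (X i) (X i') z \<partial>Pi\<^sub>M I (\<lambda>_. P1) \<partial>?Z) = (\<integral>z. \<integral>x'. \<integral>x. ?b x x' z \<partial>P1 \<partial>P1 \<partial>?Z)"
    by (intro Bochner_Integration.integral_cong refl
        integral_PiM_two_components[where C = 1, OF P1.prob_space_axioms I _ babs]) measurable
  also have "\<dots> = (\<integral>x'. \<integral>z. \<integral>x. ?b x x' z \<partial>P1 \<partial>?Z \<partial>P1)"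
    by (rule integral_swap_bounded[OF Z.prob_space_axioms P1.prob_space_axioms meas_ib iabs])
  also have "\<dots> = (\<integral>x'. \<integral>x. \<integral>z. ?b x x' z \<partial>?Z \<partial>P1 \<partial>P1)"
    by (intro Bochner_Integration.integral_cong refl
        integral_swap_bounded(1)[OF Z.prob_space_axioms P1.prob_space_axioms meas_b babs])
  also have "\<dots> \<le> (\<integral>x'. \<integral>x. g x y * g x' y * min 1 (real n * (\<integral>w. g x w * g x' w \<partial>P2)) \<partial>P1 \<partial>P1)"
  proof (rule integral_mono')
    have inner: "integrable P1 (\<lambda>x. g x y * g x' y * min 1 (real n * (\<integral>w. g x w * g x' w \<partial>P2)))" for x'
      by (rule P1.integrable_const_bound[where B = 1]) (use tabs meas_t in \<open>auto intro!: AE_I2\<close>)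
    have "\<bar>\<integral>x. g x y * g x' y * min 1 (real n * (\<integral>w. g x w * g x' w \<partial>P2)) \<partial>P1\<bar> \<le> 1" for x'
      by (intro P1.abs_integral_le tabs)
    then show "integrable P1 (\<lambda>x'. \<integral>x. g x y * g x' y * min 1 (real n * (\<integral>w. g x w * g x' w \<partial>P2)) \<partial>P1)"
      using meas_t by (intro P1.integrable_const_bound[where B = 1]) (auto intro!: P1.borel_measurable_lebesgue_integral)
    fix x'
    show "(\<integral>x. \<integral>z. ?b x x' z \<partial>?Z \<partial>P1) \<le> (\<integral>x. g x y * g x' y * min 1 (real n * (\<integral>w. g x w * g x' w \<partial>P2)) \<partial>P1)"
    proof (rule integral_mono'[OF inner int_le])
      fix x
      have "0 \<le> (\<integral>w. g x w * g x' w \<partial>P2)" using g01 by simp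
      then show "0 \<le> g x y * g x' y * min 1 (real n * (\<integral>w. g x w * g x' w \<partial>P2))"
        using g01 by (intro mult_nonneg_nonneg) auto
    qed
    show "0 \<le> (\<integral>x. g x y * g x' y * min 1 (real n * (\<integral>w. g x w * g x' w \<partial>P2)) \<partial>P1)"
      using g01 by (intro Bochner_Integration.integral_nonneg mult_nonneg_nonneg) auto
  qed
  finally show ?thesis .
qed

text \<open>With \<open>y\<close> and \<open>z\<close> frozen the attributes are independent and
  identically distributed, so the mean of the product is a power. Since \<open>z\<close> is common
  to all factors, the power has to be formed before \<open>z\<close> is averaged.\<close>

lemma integral_prod_attributes:
  fixes m n :: nat
  assumes s: "0 \<le> s" "s \<le> 1"
  shows "(\<integral>X. (\<Prod>i\<in>{1..m}. 1 - g (X i) y * (1 - (\<Prod>v\<in>{2..n}. 1 - (1 - s) * g (X i) (z v)))) \<partial>Pi\<^sub>M {1..m} (\<lambda>_. P1)) =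
    (\<integral>x. 1 - g x y * (1 - (\<Prod>v\<in>{2..n}. 1 - (1 - s) * g x (z v))) \<partial>P1) ^ m"
proof -
  note [measurable (raw)] = g_measurable
  interpret product_sigma_finite "\<lambda>_. P1" ..
  have f: "0 \<le> 1 - (1 - s) * g x w \<and> 1 - (1 - s) * g x w \<le> 1" for x w
    using s g01[of x w] mult_nonneg_nonneg[of "1 - s" "g x w"] mult_le_one[of "1 - s" "g x w"] by simp
  have R: "0 \<le> (\<Prod>v\<in>{2..n}. 1 - (1 - s) * g x (z v))" "(\<Prod>v\<in>{2..n}. 1 - (1 - s) * g x (z v)) \<le> 1" for x
    using f by (auto intro!: prod_nonneg prod_le_1)
  have "\<bar>1 - g x y * (1 - (\<Prod>v\<in>{2..n}. 1 - (1 - s) * g x (z v)))\<bar> \<le> 1" for x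
    using g01[of x y] R[of x] mult_le_one[of "g x y" "1 - (\<Prod>v\<in>{2..n}. 1 - (1 - s) * g x (z v))"]
      mult_nonneg_nonneg[of "g x y" "1 - (\<Prod>v\<in>{2..n}. 1 - (1 - s) * g x (z v))"]
    by (auto simp: abs_le_iff)
  then have "integrable P1 (\<lambda>x. 1 - g x y * (1 - (\<Prod>v\<in>{2..n}. 1 - (1 - s) * g x (z v))))"
    by (intro P1.integrable_const_bound[where B = 1]) auto
  then show ?thesis
    by (subst product_integral_prod[where f = "\<lambda>_ x. 1 - g x y * (1 - (\<Prod>v\<in>{2..n}. 1 - (1 - s) * g x (z v)))"]) auto
qed

end

end

text \<open>Weights are nonnegative only almost surely, so \<open>edge_prob\<close> can be negative
  on a null set. \<open>bernoulli_pmf\<close> clips its parameter anyway; replacing it by its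
  positive part makes the kernel [0, 1]-valued everywhere without changing the graph.\<close>

lemma bernoulli_pmf_max_0: "bernoulli_pmf (max 0 p) = bernoulli_pmf p"
  by (rule pmf_eqI) (auto simp: bernoulli_pmf.rep_eq)

section \<open>Degree and path generating functions averaged over all weights\<close>

context two_real_distributions
begin

lemma two_paths_bound_measurable:
  fixes g :: "real \<Rightarrow> real \<Rightarrow> real"
  assumes "(\<lambda>(x, y). g x y) \<in> borel_measurable (borel \<Otimes>\<^sub>M borel)"
    and "\<And>x y. 0 \<le> g x y" "\<And>x y. g x y \<le> 1"
  shows "(\<lambda>y. \<integral>x'. \<integral>x. g x y * g x' y * min 1 (c * (\<integral>w. g x w * g x' w \<partial>P2)) \<partial>P1 \<partial>P1) \<in> borel_measurable borel"
proof -
  note [measurable (raw)] = g_measurable[OF assms]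
  show ?thesis by measurable
qed

text \<open>The order of integration prepares the limits: \<open>X\<close> innermost, so that the
  attributes factorise at fixed vertex weights; \<open>z\<close> next, where concentration takes
  place; \<open>y\<close> outermost, so that all estimates are made at a fixed weight of vertex
  1.\<close>

lemma integral_split_first_vertex:
  fixes F :: "(nat \<Rightarrow> real) \<Rightarrow> (nat \<Rightarrow> real) \<Rightarrow> real"
  assumes n: "1 \<le> n"
    and F: "(\<lambda>(X, Y). F X Y) \<in> borel_measurable (Pi\<^sub>M {1..m::nat} (\<lambda>_. P1) \<Otimes>\<^sub>M Pi\<^sub>M {1..n} (\<lambda>_. P2))"
    and bound: "\<And>X Y. \<bar>F X Y\<bar> \<le> C"
  shows "(\<integral>a. F (fst a) (snd a) \<partial>(Pi\<^sub>M {1..m} (\<lambda>_. P1) \<Otimes>\<^sub>M Pi\<^sub>M {1..n} (\<lambda>_. P2))) =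
    (\<integral>y. \<integral>z. \<integral>X. F X (z(1 := y)) \<partial>Pi\<^sub>M {1..m} (\<lambda>_. P1) \<partial>Pi\<^sub>M {2..n} (\<lambda>_. P2) \<partial>P2)"
proof -
  interpret S: product_sigma_finite "\<lambda>_. P2" ..
  let ?M1 = "Pi\<^sub>M {1..m} (\<lambda>_. P1)"
  interpret M1: prob_space ?M1 by (rule prob_space_PiM) (rule P1.prob_space_axioms)
  interpret M2: prob_space "Pi\<^sub>M {1..n} (\<lambda>_. P2)" by (rule prob_space_PiM) (rule P2.prob_space_axioms)
  interpret Z: prob_space "Pi\<^sub>M {2..n} (\<lambda>_. P2)" by (rule prob_space_PiM) (rule P2.prob_space_axioms)
  have ins: "{1..n} = insert 1 {2..n}" using atLeastAtMost_insertL[OF n] by (simp add: numeral_2_eq_2)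
  have "(\<lambda>(Y, X). F X Y) \<in> borel_measurable (Pi\<^sub>M {1..n} (\<lambda>_. P2) \<Otimes>\<^sub>M ?M1)"
    using measurable_compose[OF measurable_pair_swap' F] by (simp only: case_prod_unfold fst_conv snd_conv)
  then have m: "(\<lambda>Y. \<integral>X. F X Y \<partial>?M1) \<in> borel_measurable (Pi\<^sub>M {1..n} (\<lambda>_. P2))"
    by (rule M1.borel_measurable_lebesgue_integral)
  have Fint: "\<bar>\<integral>X. F X Y \<partial>?M1\<bar> \<le> C" for Y by (rule M1.abs_integral_le[OF bound])
  have int: "integrable (Pi\<^sub>M (insert 1 {2..n}) (\<lambda>_. P2)) (\<lambda>Y. \<integral>X. F X Y \<partial>?M1)"
    unfolding ins[symmetric] by (rule M2.integrable_bounded[OF m Fint])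
  have upd: "(\<lambda>(z, y). z(1 := y)) \<in> measurable (Pi\<^sub>M {2..n} (\<lambda>_. P2) \<Otimes>\<^sub>M P2) (Pi\<^sub>M {1..n} (\<lambda>_. P2))"
    unfolding ins by (rule measurable_add_dim)
  have "(\<integral>a. F (fst a) (snd a) \<partial>(?M1 \<Otimes>\<^sub>M Pi\<^sub>M {1..n} (\<lambda>_. P2))) = (\<integral>Y. \<integral>X. F X Y \<partial>?M1 \<partial>Pi\<^sub>M {1..n} (\<lambda>_. P2))"
    by (rule integral_swap_bounded(2)[OF M1.prob_space_axioms M2.prob_space_axioms F bound])
  also have "\<dots> = (\<integral>z. \<integral>y. \<integral>X. F X (z(1 := y)) \<partial>?M1 \<partial>P2 \<partial>Pi\<^sub>M {2..n} (\<lambda>_. P2))"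
    unfolding ins by (rule S.product_integral_insert[OF _ _ int]) auto
  also have "\<dots> = (\<integral>y. \<integral>z. \<integral>X. F X (z(1 := y)) \<partial>?M1 \<partial>Pi\<^sub>M {2..n} (\<lambda>_. P2) \<partial>P2)"
    using measurable_compose[OF upd m]
    by (intro integral_swap_bounded(1)[OF Z.prob_space_axioms P2.prob_space_axioms _ Fint])
      (simp only: case_prod_unfold fst_conv snd_conv)
  finally show ?thesis .
qed

text \<open>The pair bound is averaged over everything except \<open>y\<close>. The outer
  \<open>min 1\<close> comes from both conditional means lying in [0, 1]; it is kept because the
  bound inside grows like \<open>y^2\<close>, while \<open>P2\<close> has only a first
  moment.\<close>

lemma pgf_degree_approx:
  fixes s :: real and n m :: nat
  assumes n: "1 \<le> n" and s: "0 \<le> s" "s \<le> 1"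
  defines "g \<equiv> \<lambda>x y. max 0 (edge_prob n m x y)"
  shows "\<bar>(\<integral>G. s ^ vertex_degree G 1 \<partial>random_intersection_graph P1 P2 n m) -
      (\<integral>y. \<integral>z. (\<integral>x. 1 - g x y * (1 - (\<Prod>v\<in>{2..n}. 1 - (1 - s) * g x (z v))) \<partial>P1) ^ m
        \<partial>Pi\<^sub>M {2..n} (\<lambda>_. P2) \<partial>P2)\<bar> \<le>
    (\<integral>y. min 1 ((real m)\<^sup>2 *
      (\<integral>x'. \<integral>x. g x y * g x' y * min 1 (real n * (\<integral>w. g x w * g x' w \<partial>P2)) \<partial>P1 \<partial>P1)) \<partial>P2)"
proof -
  have g: "(\<lambda>(x, y). g x y) \<in> borel_measurable (borel \<Otimes>\<^sub>M borel)"
    unfolding g_def edge_prob_def by measurable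
  have g01: "0 \<le> g x y" "g x y \<le> 1" for x y by (auto simp: g_def edge_prob_def)
  note [measurable (raw)] = g_measurable[OF g g01]
  let ?M1 = "Pi\<^sub>M {1..m} (\<lambda>_. P1)"
  let ?M2 = "Pi\<^sub>M {1..n} (\<lambda>_. P2)"
  let ?Z = "Pi\<^sub>M {2..n} (\<lambda>_. P2)"
  interpret M1: prob_space ?M1 by (rule prob_space_PiM) (rule P1.prob_space_axioms)
  interpret M2: prob_space ?M2 by (rule prob_space_PiM) (rule P2.prob_space_axioms)
  interpret Z: prob_space ?Z by (rule prob_space_PiM) (rule P2.prob_space_axioms)
  interpret M12: pair_prob_space ?M1 ?M2 ..
  interpret M1Z: pair_prob_space ?M1 ?Z ..
  define K where "K = (\<lambda>(X, Y). measure_pmf (map_pmf (intersection_graph n m) (bipartite_graph_pmf n m X Y)))"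
  have K: "K \<in> measurable (?M1 \<Otimes>\<^sub>M ?M2) (subprob_algebra (count_space UNIV))"
    unfolding K_def by (rule measurable_bipartite_kernel) simp_all
  have RG: "random_intersection_graph P1 P2 n m = (?M1 \<Otimes>\<^sub>M ?M2) \<bind> K"
    unfolding random_intersection_graph_def K_def ..
  \<comment> \<open>Given all weights, \<open>D\<close> and \<open>W\<close> are the means of
    \<open>s\<close> to the degree and of \<open>path_weight\<close>, and \<open>B\<close> bounds
    their distance.\<close>
  define D where "D = (\<lambda>X Y. measure_pmf.expectation (bipartite_graph_pmf n m X Y)
      (\<lambda>H. s ^ vertex_degree (intersection_graph n m H) 1))"
  define W where "W = (\<lambda>X Y. \<Prod>i\<in>{1..m}. 1 - g (X i) (Y 1) * (1 - (\<Prod>v\<in>{2..n}. 1 - (1 - s) * g (X i) (Y v))))"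
  define b where "b = (\<lambda>i i' (X :: nat \<Rightarrow> real) (Y :: nat \<Rightarrow> real). g (X i) (Y 1) * g (X i') (Y 1) *
      min 1 (\<Sum>v\<in>{2..n}. g (X i) (Y v) * g (X i') (Y v)))"
  define B where "B = (\<lambda>X Y. \<Sum>i\<in>{1..m}. \<Sum>i'\<in>{1..m} - {i}. b i i' X Y)"
  define T where "T = (\<lambda>y. \<integral>x'. \<integral>x. g x y * g x' y * min 1 (real n * (\<integral>w. g x w * g x' w \<partial>P2)) \<partial>P1 \<partial>P1)"

  have bip: "bipartite_graph_pmf n m X Y =
      Pi_pmf ({1..m} \<times> {1..n}) False (\<lambda>x. bernoulli_pmf (g (X (fst x)) (Y (snd x))))" for X Y
    unfolding bipartite_graph_pmf_def g_def bernoulli_pmf_max_0 by (simp add: case_prod_unfold)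
  have pow01: "0 \<le> s ^ k" "s ^ k \<le> 1" for k using s by (auto simp: power_le_one)
  have D01: "0 \<le> D X Y" "D X Y \<le> 1" for X Y
  proof -
    show "0 \<le> D X Y" unfolding D_def using pow01 by simp
    have "D X Y \<le> measure_pmf.expectation (bipartite_graph_pmf n m X Y) (\<lambda>_. 1)"
      unfolding D_def by (rule integral_mono') (use pow01 in auto)
    then show "D X Y \<le> 1" by simp
  qed
  have D_eq: "D X Y = (\<integral>G. s ^ vertex_degree G 1 \<partial>K (X, Y))" for X Y
    by (simp add: D_def K_def)
  have D_meas: "(\<lambda>(X, Y). D X Y) \<in> borel_measurable (?M1 \<Otimes>\<^sub>M ?M2)"
    unfolding D_eq case_prod_unfold prod.collapse
    by (rule measurable_compose[OF K integral_measurable_subprob_algebra]) simp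
  have fac: "0 \<le> 1 - (1 - s) * g x w" "1 - (1 - s) * g x w \<le> 1" for x w
    using s g01[of x w] mult_nonneg_nonneg[of "1 - s" "g x w"] mult_le_one[of "1 - s" "g x w"] by auto
  have R: "0 \<le> (\<Prod>v\<in>{2..n}. 1 - (1 - s) * g x (Y v))" "(\<Prod>v\<in>{2..n}. 1 - (1 - s) * g x (Y v)) \<le> 1" for x Y
    using fac by (auto intro!: prod_nonneg prod_le_1)
  have row: "0 \<le> 1 - g x y * (1 - (\<Prod>v\<in>{2..n}. 1 - (1 - s) * g x (Y v)))"
      "1 - g x y * (1 - (\<Prod>v\<in>{2..n}. 1 - (1 - s) * g x (Y v))) \<le> 1" for x y Y
    using g01[of x y] R[of x Y] mult_le_one[of "g x y" "1 - (\<Prod>v\<in>{2..n}. 1 - (1 - s) * g x (Y v))"]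
      mult_nonneg_nonneg[of "g x y" "1 - (\<Prod>v\<in>{2..n}. 1 - (1 - s) * g x (Y v))"]
    by linarith+
  have W01: "0 \<le> W X Y" "W X Y \<le> 1" for X Y
    unfolding W_def using row by (auto intro!: prod_nonneg prod_le_1)
  have comp1: "(\<lambda>a. fst a i) \<in> borel_measurable (?M1 \<Otimes>\<^sub>M ?M2)" if "i \<in> {1..m}" for i
    by (subst measurable_cong_sets[OF refl P1.events_eq_borel[symmetric]])
      (rule measurable_compose[OF measurable_fst measurable_component_singleton[OF that]])
  have comp2: "(\<lambda>a. snd a v) \<in> borel_measurable (?M1 \<Otimes>\<^sub>M ?M2)" if "v \<in> {1..n}" for v
    by (subst measurable_cong_sets[OF refl P2.events_eq_borel[symmetric]])
      (rule measurable_compose[OF measurable_snd measurable_component_singleton[OF that]])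
  note borel_intros = borel_measurable_prod borel_measurable_sum borel_measurable_diff borel_measurable_const
    borel_measurable_times borel_measurable_min g_measurable[OF g g01] comp1 comp2
  have W_meas: "(\<lambda>(X, Y). W X Y) \<in> borel_measurable (?M1 \<Otimes>\<^sub>M ?M2)"
    unfolding W_def case_prod_unfold using n by (intro borel_intros) simp_all
  have b_meas: "(\<lambda>(X, Y). b i i' X Y) \<in> borel_measurable (?M1 \<Otimes>\<^sub>M ?M2)"
    if "i \<in> {1..m}" "i' \<in> {1..m}" for i i'
    unfolding b_def case_prod_unfold using n that by (intro borel_intros) simp_all
  have b0: "0 \<le> b i i' X Y" for i i' X Y
    unfolding b_def by (intro mult_nonneg_nonneg min.boundedI zero_le_one sum_nonneg g01)
  have b1: "b i i' X Y \<le> 1" for i i' X Y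
    unfolding b_def
    by (intro mult_le_one[OF mult_le_one min.boundedI min.cobounded1] mult_nonneg_nonneg zero_le_one sum_nonneg g01)
  have babs: "\<bar>b i i' X Y\<bar> \<le> 1" for i i' X Y using b0[of i i' X Y] b1[of i i' X Y] by linarith
  have B0: "0 \<le> B X Y" for X Y unfolding B_def by (intro sum_nonneg b0)
  have B_meas: "(\<lambda>(X, Y). B X Y) \<in> borel_measurable (?M1 \<Otimes>\<^sub>M ?M2)"
    unfolding B_def case_prod_unfold
    by (intro borel_measurable_sum b_meas[unfolded case_prod_unfold]) simp_all

  have approx: "\<bar>D X Y - W X Y\<bar> \<le> min 1 (B X Y)" for X Y
  proof -
    have "\<bar>D X Y - W X Y\<bar> \<le> B X Y"
      using expectation_power_degree_approx[of n m "\<lambda>x. g (X (fst x)) (Y (snd x))" s]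
        expectation_path_weight[of n m "\<lambda>x. g (X (fst x)) (Y (snd x))" s] n s g01
      unfolding D_def W_def B_def b_def bip by simp
    moreover have "\<bar>D X Y - W X Y\<bar> \<le> 1" using D01[of X Y] W01[of X Y] by linarith
    ultimately show ?thesis by simp
  qed
  have Dabs: "\<bar>D X Y\<bar> \<le> 1" and Wabs: "\<bar>W X Y\<bar> \<le> 1" and Babs: "\<bar>min 1 (B X Y)\<bar> \<le> 1" for X Y
    using D01[of X Y] W01[of X Y] B0[of X Y] by (auto simp: min_def)
  have minB_meas: "(\<lambda>(X, Y). min 1 (B X Y)) \<in> borel_measurable (?M1 \<Otimes>\<^sub>M ?M2)"
    unfolding case_prod_unfold
    by (intro borel_measurable_min borel_measurable_const B_meas[unfolded case_prod_unfold])

  \<comment> \<open>The bind is resolved for nonnegative integrals, where no integrability has to be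
    shown; the integrand is nonnegative, so both conversions are available.\<close>
  have "(\<integral>G. s ^ vertex_degree G 1 \<partial>random_intersection_graph P1 P2 n m) =
      enn2real (\<integral>\<^sup>+G. ennreal (s ^ vertex_degree G 1) \<partial>random_intersection_graph P1 P2 n m)"
  proof (rule integral_eq_nn_integral)
    show "(\<lambda>G. s ^ vertex_degree G 1) \<in> borel_measurable (random_intersection_graph P1 P2 n m)"
      by (subst measurable_cong_sets[OF _ refl, where M' = "count_space UNIV"])
        (simp_all add: sets_random_intersection_graph[OF P1.real_distribution_axioms P2.real_distribution_axioms])
  qed (simp add: pow01)
  also have "(\<integral>\<^sup>+G. ennreal (s ^ vertex_degree G 1) \<partial>random_intersection_graph P1 P2 n m) =
      (\<integral>\<^sup>+a. \<integral>\<^sup>+G. ennreal (s ^ vertex_degree G 1) \<partial>K a \<partial>(?M1 \<Otimes>\<^sub>M ?M2))"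
    unfolding RG by (rule nn_integral_bind[OF _ K]) simp
  also have "\<dots> = (\<integral>\<^sup>+a. ennreal (D (fst a) (snd a)) \<partial>(?M1 \<Otimes>\<^sub>M ?M2))"
  proof (rule nn_integral_cong)
    fix a
    show "(\<integral>\<^sup>+G. ennreal (s ^ vertex_degree G 1) \<partial>K a) = ennreal (D (fst a) (snd a))"
      unfolding D_eq K_def case_prod_unfold prod.collapse using pow01
      by (intro nn_integral_eq_integral measure_pmf.integrable_bounded[where C = 1]) simp_all
  qed
  also have "enn2real \<dots> = (\<integral>a. D (fst a) (snd a) \<partial>(?M1 \<Otimes>\<^sub>M ?M2))"
    using D01(1) by (intro integral_eq_nn_integral[symmetric] D_meas[unfolded case_prod_unfold]) simp
  finally have int_D: "(\<integral>G. s ^ vertex_degree G 1 \<partial>random_intersection_graph P1 P2 n m) =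
      (\<integral>a. D (fst a) (snd a) \<partial>(?M1 \<Otimes>\<^sub>M ?M2))" .

  have int: "integrable (?M1 \<Otimes>\<^sub>M ?M2) (\<lambda>a. D (fst a) (snd a))"
      "integrable (?M1 \<Otimes>\<^sub>M ?M2) (\<lambda>a. W (fst a) (snd a))"
      "integrable (?M1 \<Otimes>\<^sub>M ?M2) (\<lambda>a. min 1 (B (fst a) (snd a)))"
    using M12.integrable_bounded[where C = 1, OF D_meas] M12.integrable_bounded[where C = 1, OF W_meas]
      M12.integrable_bounded[where C = 1, OF minB_meas] Dabs Wabs Babs
    by (simp_all only: case_prod_unfold simp_thms)

  have int_W: "(\<integral>a. W (fst a) (snd a) \<partial>(?M1 \<Otimes>\<^sub>M ?M2)) =
      (\<integral>y. \<integral>z. (\<integral>x. 1 - g x y * (1 - (\<Prod>v\<in>{2..n}. 1 - (1 - s) * g x (z v))) \<partial>P1) ^ m \<partial>?Z \<partial>P2)"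
    unfolding integral_split_first_vertex[OF n W_meas Wabs]
      integral_prod_attributes[OF g g01 s, symmetric]
    by (intro Bochner_Integration.integral_cong refl) (auto simp: W_def intro!: prod.cong)

  have T_bound: "(\<integral>z. \<integral>X. min 1 (B X (z(1 := y))) \<partial>?M1 \<partial>?Z) \<le> min 1 ((real m)\<^sup>2 * T y)" for y
  proof -
    have upd: "(\<lambda>a. (fst a, (snd a)(1 := y))) \<in> measurable (?M1 \<Otimes>\<^sub>M ?Z) (?M1 \<Otimes>\<^sub>M ?M2)"
    proof -
      have "{1..n} = insert 1 {2..n}" using atLeastAtMost_insertL[OF n] by (simp add: numeral_2_eq_2)
      then show ?thesis by (auto intro!: measurable_Pair measurable_fun_upd)
    qed
    have m: "(\<lambda>(X, z). b i i' X (z(1 := y))) \<in> borel_measurable (?M1 \<Otimes>\<^sub>M ?Z)"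
      if "i \<in> {1..m}" "i' \<in> {1..m}" for i i'
      using measurable_compose[OF upd b_meas[OF that]] by (simp only: case_prod_unfold fst_conv snd_conv)
    have bi: "integrable (?M1 \<Otimes>\<^sub>M ?Z) (\<lambda>a. b i i' (fst a) ((snd a)(1 := y)))"
      if "i \<in> {1..m}" "i' \<in> {1..m}" for i i'
      using M1Z.integrable_bounded[where C = 1, OF m[OF that]] babs by (simp only: case_prod_unfold simp_thms)
    have mB: "(\<lambda>(X, z). min 1 (B X (z(1 := y)))) \<in> borel_measurable (?M1 \<Otimes>\<^sub>M ?Z)"
      using measurable_compose[OF upd minB_meas] by (simp only: case_prod_unfold fst_conv snd_conv)
    have iB: "integrable (?M1 \<Otimes>\<^sub>M ?Z) (\<lambda>a. B (fst a) ((snd a)(1 := y)))"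
      unfolding B_def by (intro Bochner_Integration.integrable_sum bi) auto
    have bT: "(\<integral>a. b i i' (fst a) ((snd a)(1 := y)) \<partial>(?M1 \<Otimes>\<^sub>M ?Z)) \<le> T y"
      if "i \<in> {1..m}" "i' \<in> {1..m}" "i \<noteq> i'" for i i'
    proof -
      have "(\<integral>a. b i i' (fst a) ((snd a)(1 := y)) \<partial>(?M1 \<Otimes>\<^sub>M ?Z)) =
          (\<integral>z. \<integral>X. b i i' X (z(1 := y)) \<partial>?M1 \<partial>?Z)"
        by (rule integral_swap_bounded(2)[OF M1.prob_space_axioms Z.prob_space_axioms m[OF that(1,2)] babs])
      also have "\<dots> = (\<integral>z. \<integral>X. g (X i) y * g (X i') y * min 1 (\<Sum>v\<in>{2..n}. g (X i) (z v) * g (X i') (z v)) \<partial>?M1 \<partial>?Z)"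
        unfolding b_def by (intro Bochner_Integration.integral_cong refl arg_cong2[where f = "(*)"] arg_cong2[where f = min] sum.cong) auto
      also have "\<dots> \<le> T y" unfolding T_def using that by (intro integral_two_paths_le[OF g g01]) auto
      finally show ?thesis .
    qed
    have T0: "0 \<le> T y" unfolding T_def
      using g01 by (intro Bochner_Integration.integral_nonneg mult_nonneg_nonneg) auto
    have "(\<integral>z. \<integral>X. min 1 (B X (z(1 := y))) \<partial>?M1 \<partial>?Z) = (\<integral>a. min 1 (B (fst a) ((snd a)(1 := y))) \<partial>(?M1 \<Otimes>\<^sub>M ?Z))"
      by (rule integral_swap_bounded(2)[OF M1.prob_space_axioms Z.prob_space_axioms mB Babs, symmetric])
    also have "\<dots> \<le> min 1 (\<integral>a. B (fst a) ((snd a)(1 := y)) \<partial>(?M1 \<Otimes>\<^sub>M ?Z))"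
      by (rule integral_min_one_le[OF M1Z.prob_space_axioms iB])
    also have "(\<integral>a. B (fst a) ((snd a)(1 := y)) \<partial>(?M1 \<Otimes>\<^sub>M ?Z)) =
        (\<Sum>i\<in>{1..m}. \<Sum>i'\<in>{1..m} - {i}. \<integral>a. b i i' (fst a) ((snd a)(1 := y)) \<partial>(?M1 \<Otimes>\<^sub>M ?Z))"
    proof -
      have "(\<integral>a. B (fst a) ((snd a)(1 := y)) \<partial>(?M1 \<Otimes>\<^sub>M ?Z)) =
          (\<Sum>i\<in>{1..m}. \<integral>a. (\<Sum>i'\<in>{1..m} - {i}. b i i' (fst a) ((snd a)(1 := y))) \<partial>(?M1 \<Otimes>\<^sub>M ?Z))"
        unfolding B_def
        by (rule Bochner_Integration.integral_sum) (intro Bochner_Integration.integrable_sum bi, simp_all)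
      also have "\<dots> = (\<Sum>i\<in>{1..m}. \<Sum>i'\<in>{1..m} - {i}. \<integral>a. b i i' (fst a) ((snd a)(1 := y)) \<partial>(?M1 \<Otimes>\<^sub>M ?Z))"
        by (intro sum.cong refl Bochner_Integration.integral_sum bi) simp_all
      finally show ?thesis .
    qed
    also have "\<dots> \<le> (\<Sum>i\<in>{1..m}. \<Sum>i'\<in>{1..m} - {i}. T y)" by (intro sum_mono bT) auto
    \<comment> \<open>The diagonal pairs are added to obtain the round factor
      \<open>m^2\<close>.\<close>
    also have "\<dots> \<le> (\<Sum>i\<in>{1..m}. \<Sum>i'\<in>{1..m}. T y)"
      by (intro sum_mono sum_mono2 T0) auto
    also have "\<dots> = (real m)\<^sup>2 * T y" by (simp add: power2_eq_square)
    finally show ?thesis by (simp only: fun_upd_def min.mono order_refl)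
  qed

  have "\<bar>(\<integral>a. D (fst a) (snd a) \<partial>(?M1 \<Otimes>\<^sub>M ?M2)) - (\<integral>a. W (fst a) (snd a) \<partial>(?M1 \<Otimes>\<^sub>M ?M2))\<bar> =
      \<bar>\<integral>a. D (fst a) (snd a) - W (fst a) (snd a) \<partial>(?M1 \<Otimes>\<^sub>M ?M2)\<bar>"
    using int by simp
  also have "\<dots> \<le> (\<integral>a. \<bar>D (fst a) (snd a) - W (fst a) (snd a)\<bar> \<partial>(?M1 \<Otimes>\<^sub>M ?M2))"
    by (rule integral_abs_bound)
  also have "\<dots> \<le> (\<integral>a. min 1 (B (fst a) (snd a)) \<partial>(?M1 \<Otimes>\<^sub>M ?M2))"
    using int by (intro integral_mono approx) auto
  also have "\<dots> = (\<integral>y. \<integral>z. \<integral>X. min 1 (B X (z(1 := y))) \<partial>?M1 \<partial>?Z \<partial>P2)"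
    by (rule integral_split_first_vertex[OF n minB_meas Babs])
  also have "\<dots> \<le> (\<integral>y. min 1 ((real m)\<^sup>2 * T y) \<partial>P2)"
  proof (rule integral_mono'[OF _ T_bound])
    have T0: "0 \<le> T y" for y unfolding T_def
      using g01 by (intro Bochner_Integration.integral_nonneg mult_nonneg_nonneg) auto
    then show "0 \<le> min 1 ((real m)\<^sup>2 * T y)" for y by simp
    have "T \<in> borel_measurable P2"
      unfolding T_def by (subst measurable_cong_sets[OF P2.events_eq_borel refl]) (rule two_paths_bound_measurable[OF g g01])
    then show "integrable P2 (\<lambda>y. min 1 ((real m)\<^sup>2 * T y))"
      using T0 by (intro P2.integrable_bounded[where C = 1] borel_measurable_min borel_measurable_const borel_measurable_times) auto
  qed
  finally show ?thesis unfolding int_D int_W T_def .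
qed

end

section \<open>Limits\<close>

text \<open>On [0, 1] the numbers \<open>1 - u\<close> and \<open>exp (- u)\<close> differ by at
  most \<open>u^2\<close>, so their \<open>N\<close>-th powers differ by at most
  \<open>N * u^2\<close>, which is \<open>(N * u)^2 / N\<close> and tends to 0.\<close>

lemma tendsto_one_minus_power_exp:
  fixes u :: "nat \<Rightarrow> real" and N :: "nat \<Rightarrow> nat"
  assumes N: "filterlim N at_top sequentially" and u: "eventually (\<lambda>k. 0 \<le> u k \<and> u k \<le> 1) sequentially"
    and lim: "(\<lambda>k. real (N k) * u k) \<longlonglongrightarrow> l"
  shows "(\<lambda>k. (1 - u k) ^ N k) \<longlonglongrightarrow> exp (- l)"
proof -
  have invN: "(\<lambda>k. inverse (real (N k))) \<longlonglongrightarrow> 0"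
    by (intro tendsto_inverse_0_at_top filterlim_compose[OF filterlim_real_sequentially N])
  have "(\<lambda>k. (real (N k) * u k)\<^sup>2 * inverse (real (N k))) \<longlonglongrightarrow> l\<^sup>2 * 0"
    by (intro tendsto_intros lim invN)
  then have lim0: "(\<lambda>k. (real (N k) * u k)\<^sup>2 * inverse (real (N k))) \<longlonglongrightarrow> 0" by simp
  have "eventually (\<lambda>k. norm ((1 - u k) ^ N k - exp (- (real (N k) * u k))) \<le> (real (N k) * u k)\<^sup>2 * inverse (real (N k))) sequentially"
    using u
  proof eventually_elim
    fix k assume u: "0 \<le> u k \<and> u k \<le> 1"
    have low: "1 - u k \<le> exp (- u k)" using exp_ge_add_one_self[of "- u k"] by simp
    have "exp (- u k) \<le> inverse (1 + u k)"
      using u exp_ge_add_one_self[of "u k"] by (simp add: exp_minus le_imp_inverse_le)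
    also have "\<dots> \<le> 1 - u k + (u k)\<^sup>2"
    proof -
      \<comment> \<open>The product equals \<open>1 + u^3\<close>.\<close>
      have "1 \<le> (1 - u k + (u k)\<^sup>2) * (1 + u k)"
        using u by (simp add: algebra_simps power2_eq_square)
      then show ?thesis using u by (simp add: inverse_eq_divide pos_divide_le_eq)
    qed
    finally have high: "exp (- u k) \<le> 1 - u k + (u k)\<^sup>2" .
    have "norm ((1 - u k) ^ N k - exp (- u k) ^ N k) \<le> N k * norm ((1 - u k) - exp (- u k))"
      using u by (intro norm_power_diff) auto
    also have "\<dots> \<le> N k * (u k)\<^sup>2"
      using low high by (intro mult_left_mono) auto
    also have "\<dots> = (real (N k) * u k)\<^sup>2 * inverse (real (N k))"
      by (cases "N k = 0") (simp_all add: power2_eq_square)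
    finally show "norm ((1 - u k) ^ N k - exp (- (real (N k) * u k))) \<le> (real (N k) * u k)\<^sup>2 * inverse (real (N k))"
      by (simp add: exp_of_nat_mult[symmetric])
  qed
  then have "(\<lambda>k. (1 - u k) ^ N k - exp (- (real (N k) * u k))) \<longlonglongrightarrow> 0"
    by (rule Lim_null_comparison[OF _ lim0])
  moreover have "(\<lambda>k. exp (- (real (N k) * u k))) \<longlonglongrightarrow> exp (- l)"
    by (intro tendsto_intros lim)
  ultimately show ?thesis using tendsto_add[of "\<lambda>k. (1 - u k) ^ N k - exp (- (real (N k) * u k))" 0 sequentially] by fastforce
qed

text \<open>This is nonnegativity of the variance of |f|; it turns convergence of two moments into
  convergence in mean.\<close>

lemma (in prob_space) expectation_abs_le_sqrt:
  fixes f :: "'a \<Rightarrow> real"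
  assumes [measurable]: "f \<in> borel_measurable M" and bound: "\<And>x. \<bar>f x\<bar> \<le> C"
  shows "expectation (\<lambda>x. \<bar>f x\<bar>) \<le> sqrt (expectation (\<lambda>x. (f x)\<^sup>2))"
proof -
  have "integrable M (\<lambda>x. (\<bar>f x\<bar>)\<^sup>2)"
    by (rule integrable_bounded[where C = "C\<^sup>2"]) (use bound in \<open>auto simp: abs_le_square_iff[symmetric] intro: order_trans[OF _ abs_ge_self]\<close>)
  moreover have "integrable M (\<lambda>x. \<bar>f x\<bar>)"
    by (rule integrable_bounded[where C = C]) (use bound in auto)
  ultimately have "(expectation (\<lambda>x. \<bar>f x\<bar>))\<^sup>2 \<le> expectation (\<lambda>x. (f x)\<^sup>2)"
    using variance_eq[of "\<lambda>x. \<bar>f x\<bar>"] variance_positive[of "\<lambda>x. \<bar>f x\<bar>"] by simp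
  then show ?thesis by (rule real_le_rsqrt)
qed

text \<open>Separates the error of the edge rate from the error of the product \<open>Q\<close>.
  Only the second summand will depend on \<open>z\<close>, and its prefactor will not, so the
  average over \<open>z\<close> hits |Q - q| alone.\<close>

lemma abs_rate_diff_le:
  fixes r p :: real
  assumes "0 \<le> r * p" "0 \<le> q" "q \<le> 1"
  shows "\<bar>r * (p * (1 - Q)) - l * y * (x * (1 - q))\<bar> \<le> \<bar>r * p - l * (x * y)\<bar> + r * p * \<bar>Q - q\<bar>"
proof -
  have "r * (p * (1 - Q)) - l * y * (x * (1 - q)) = (r * p - l * (x * y)) * (1 - q) + r * p * (q - Q)"
    by (simp add: algebra_simps)
  then have "\<bar>r * (p * (1 - Q)) - l * y * (x * (1 - q))\<bar> \<le> \<bar>(r * p - l * (x * y)) * (1 - q)\<bar> + \<bar>r * p * (q - Q)\<bar>"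
    by (simp only: abs_triangle_ineq)
  also have "\<bar>(r * p - l * (x * y)) * (1 - q)\<bar> \<le> \<bar>r * p - l * (x * y)\<bar> * 1"
    using assms unfolding abs_mult[of _ "1 - q"] by (intro mult_left_mono) auto
  also have "\<bar>r * p * (q - Q)\<bar> = r * p * \<bar>Q - q\<bar>"
    using assms unfolding abs_mult[of _ "q - Q"] by (simp add: abs_minus_commute)
  finally show ?thesis by simp
qed

section \<open>Rates and dominating functions for a fixed argument \<open>s\<close>\<close>

locale intersection_graph_limit = two_real_distributions +
  fixes n m :: "nat \<Rightarrow> nat" and \<beta> s :: real
  assumes nonneg1: "AE x in P1. 0 \<le> x" and int1: "integrable P1 (\<lambda>x. x)"
    and nonneg2: "AE y in P2. 0 \<le> y" and int2: "integrable P2 (\<lambda>y. y)"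
    and beta: "0 < \<beta>"
    and n: "filterlim n at_top sequentially" and m: "filterlim m at_top sequentially"
    and ratio: "(\<lambda>k. real (m k) / real (n k)) \<longlonglongrightarrow> \<beta>"
    and s: "0 \<le> s" "s \<le> 1"
begin

definition c :: "nat \<Rightarrow> real" where "c k = sqrt (real (n k) * real (m k))"
definition g :: "nat \<Rightarrow> real \<Rightarrow> real \<Rightarrow> real" where "g k = (\<lambda>x y. max 0 (edge_prob (n k) (m k) x y))"
definition b1 :: real where "b1 = (\<integral>y. y \<partial>P2)"
text \<open>Generating function at \<open>s\<close> of a Poisson variable with mean
  \<open>x * b1 / sqrt \<beta>\<close>. For nonnegative weights it is the limit of \<open>Q\<close>,
  the conditional generating function of the number of vertices other than 1 joined to an attribute
  of weight \<open>x\<close>.\<close>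

definition q :: "real \<Rightarrow> real" where "q x = exp (- ((1 - s) * (x * b1 / sqrt \<beta>)))"
definition Q :: "nat \<Rightarrow> real \<Rightarrow> (nat \<Rightarrow> real) \<Rightarrow> real" where
  "Q k x z = (\<Prod>v\<in>{2..n k}. 1 - (1 - s) * g k x (z v))"
definition Z :: "nat \<Rightarrow> (nat \<Rightarrow> real) measure" where "Z k = Pi\<^sub>M {2..n k} (\<lambda>_. P2)"

sublocale Z: prob_space "Z k" for k
  unfolding Z_def by (rule prob_space_PiM) (rule P2.prob_space_axioms)

lemma g_meas: "(\<lambda>(x, y). g k x y) \<in> borel_measurable (borel \<Otimes>\<^sub>M borel)"
  unfolding g_def edge_prob_def by measurable

lemma g01: "0 \<le> g k x y" "g k x y \<le> 1"
  by (auto simp: g_def edge_prob_def)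

lemmas g_comp[measurable (raw)] = g_measurable[OF g_meas g01]

lemma g_le: "0 \<le> x \<Longrightarrow> 0 \<le> y \<Longrightarrow> g k x y \<le> x * y / c k"
  by (simp add: g_def edge_prob_def c_def)

lemma c_at_top: "filterlim c at_top sequentially"
proof -
  have "filterlim (\<lambda>k. real (n k) * real (m k)) at_top sequentially"
    by (intro filterlim_at_top_mult_at_top filterlim_compose[OF filterlim_real_sequentially] n m)
  then show ?thesis unfolding c_def by (rule filterlim_compose[OF sqrt_at_top])
qed

text \<open>For fixed weights no truncation is active once \<open>c k\<close> exceeds
  \<open>x * y\<close>. The index depends on the weights, so limits are taken pointwise and
  integrated by dominated convergence.\<close>

lemma g_eventually_eq:
  assumes "0 \<le> x" "0 \<le> y"
  shows "eventually (\<lambda>k. g k x y = x * y / c k) sequentially"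
proof -
  have "eventually (\<lambda>k. x * y + 1 \<le> c k) sequentially"
    using c_at_top by (simp add: filterlim_at_top)
  then show ?thesis
  proof eventually_elim
    case (elim k)
    have xy: "0 \<le> x * y" using assms by simp
    then have "x * y / c k \<le> 1" using elim by (simp add: divide_le_eq)
    then show ?case using xy elim by (simp add: g_def edge_prob_def c_def)
  qed
qed

text \<open>The ratio is \<open>sqrt (m / n)\<close> for every \<open>k\<close>; if
  \<open>n k\<close> or \<open>m k\<close> is 0, both sides vanish because division by 0 gives
  0.\<close>

lemma m_over_c: "(\<lambda>k. real (m k) / c k) \<longlonglongrightarrow> sqrt \<beta>"
proof -
  have "real (m k) / c k = sqrt (real (m k) / real (n k))" for k
    by (cases "m k = 0"; cases "n k = 0") (auto simp: c_def real_sqrt_mult real_sqrt_divide field_simps)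
  then show ?thesis using tendsto_real_sqrt[OF ratio] by simp
qed

lemma n_over_c: "(\<lambda>k. real (n k) / c k) \<longlonglongrightarrow> 1 / sqrt \<beta>"
proof -
  have "real (n k) / c k = 1 / sqrt (real (m k) / real (n k))" for k
    by (cases "m k = 0"; cases "n k = 0") (auto simp: c_def real_sqrt_mult real_sqrt_divide field_simps)
  then show ?thesis using tendsto_divide[OF tendsto_const tendsto_real_sqrt[OF ratio], of 1] beta by simp
qed

text \<open>One constant for all indices, as dominated convergence asks for its bound at every
  \<open>k\<close>.\<close>

lemma rates_bounded: "\<exists>C\<ge>0. \<forall>k. real (n k) / c k \<le> C \<and> real (m k) / c k \<le> C"
proof -
  obtain A B where A: "\<And>k. \<bar>real (n k) / c k\<bar> \<le> A" and B: "\<And>k. \<bar>real (m k) / c k\<bar> \<le> B"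
    using convergent_imp_Bseq[OF convergentI[OF n_over_c]] convergent_imp_Bseq[OF convergentI[OF m_over_c]]
    unfolding Bseq_def real_norm_def by metis
  show ?thesis
  proof (intro exI[of _ "max A B"] conjI allI)
    show "0 \<le> max A B" using A[of 0] by linarith
    show "real (n k) / c k \<le> max A B" "real (m k) / c k \<le> max A B" for k using A[of k] B[of k] by linarith+
  qed
qed

definition C :: real where "C = (SOME C. C \<ge> 0 \<and> (\<forall>k. real (n k) / c k \<le> C \<and> real (m k) / c k \<le> C))"

lemma C: "0 \<le> C" "real (n k) / c k \<le> C" "real (m k) / c k \<le> C"
  using someI_ex[OF rates_bounded] unfolding C_def by blast+

text \<open>These bounds supply the dominating functions. They are linear in each weight, which is
  why first moments suffice.\<close>

lemma ng_le:
  assumes "0 \<le> x" "0 \<le> y"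
  shows "real (n k) * g k x y \<le> C * (x * y)" "real (m k) * g k x y \<le> C * (x * y)"
proof -
  have "real r * g k x y \<le> C * (x * y)" if "real r / c k \<le> C" for r
  proof -
    have "real r * g k x y \<le> real r * (x * y / c k)" by (intro mult_left_mono g_le assms) simp
    also have "\<dots> = real r / c k * (x * y)" by simp
    also have "\<dots> \<le> C * (x * y)" using that assms by (intro mult_right_mono) auto
    finally show ?thesis .
  qed
  then show "real (n k) * g k x y \<le> C * (x * y)" "real (m k) * g k x y \<le> C * (x * y)" using C by auto
qed

lemma ng_tendsto:
  assumes "0 \<le> x" "0 \<le> y"
  shows "(\<lambda>k. real (n k) * g k x y) \<longlonglongrightarrow> 1 / sqrt \<beta> * (x * y)" "(\<lambda>k. real (m k) * g k x y) \<longlonglongrightarrow> sqrt \<beta> * (x * y)"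
proof -
  have "(\<lambda>k. real (r k) * g k x y) \<longlonglongrightarrow> l * (x * y)" if "(\<lambda>k. real (r k) / c k) \<longlonglongrightarrow> l" for r :: "nat \<Rightarrow> nat" and l
  proof (rule Lim_transform_eventually)
    show "(\<lambda>k. real (r k) / c k * (x * y)) \<longlonglongrightarrow> l * (x * y)" by (intro tendsto_intros that)
    show "eventually (\<lambda>k. real (r k) / c k * (x * y) = real (r k) * g k x y) sequentially"
      using g_eventually_eq[OF assms] by eventually_elim simp
  qed
  from this[OF n_over_c] this[OF m_over_c]
  show "(\<lambda>k. real (n k) * g k x y) \<longlonglongrightarrow> 1 / sqrt \<beta> * (x * y)" "(\<lambda>k. real (m k) * g k x y) \<longlonglongrightarrow> sqrt \<beta> * (x * y)"
    by -
qed

lemma g_tendsto_0: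
  assumes "0 \<le> x" "0 \<le> y"
  shows "(\<lambda>k. g k x y) \<longlonglongrightarrow> 0"
proof (rule Lim_transform_eventually)
  show "(\<lambda>k. x * y / c k) \<longlonglongrightarrow> 0"
    by (intro real_tendsto_divide_at_top[OF tendsto_const] c_at_top)
  show "eventually (\<lambda>k. x * y / c k = g k x y) sequentially"
    using g_eventually_eq[OF assms] by eventually_elim simp
qed

section \<open>Mean numbers of vertices joined to one or two given attributes\<close>

lemma n_integral_g:
  assumes x: "0 \<le> x"
  shows "(\<lambda>k. real (n k) * (\<integral>w. g k x w \<partial>P2)) \<longlonglongrightarrow> x * b1 / sqrt \<beta>"
proof -
  have "(\<lambda>k. \<integral>w. real (n k) * g k x w \<partial>P2) \<longlonglongrightarrow> (\<integral>w. 1 / sqrt \<beta> * (x * w) \<partial>P2)"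
  proof (rule integral_dominated_convergence[where w = "\<lambda>w. C * (x * w)"])
    show "integrable P2 (\<lambda>w. C * (x * w))" using int2 by simp
    show "AE w in P2. (\<lambda>k. real (n k) * g k x w) \<longlonglongrightarrow> 1 / sqrt \<beta> * (x * w)"
      using nonneg2 by eventually_elim (rule ng_tendsto[OF x])
    show "AE w in P2. norm (real (n k) * g k x w) \<le> C * (x * w)" for k
      using nonneg2 by eventually_elim (simp add: g01 ng_le[OF x])
  qed simp_all
  then show ?thesis by (simp add: b1_def)
qed

text \<open>One factor, multiplied by \<open>n\<close>, is dominated by a multiple of
  \<open>w\<close>, while the other tends to 0; no second moment of \<open>P2\<close> enters. The
  case \<open>x = x'\<close> kills the quadratic term in the second moment of \<open>Q\<close>; the
  general case makes coincidences negligible.\<close>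

lemma n_integral_gg:
  assumes x: "0 \<le> x" and x': "0 \<le> x'"
  shows "(\<lambda>k. real (n k) * (\<integral>w. g k x w * g k x' w \<partial>P2)) \<longlonglongrightarrow> 0"
proof -
  have "(\<lambda>k. \<integral>w. real (n k) * (g k x w * g k x' w) \<partial>P2) \<longlonglongrightarrow> (\<integral>w. 0 \<partial>P2)"
  proof (rule integral_dominated_convergence[where w = "\<lambda>w. C * (x * w)"])
    show "integrable P2 (\<lambda>w. C * (x * w))" using int2 by simp
    show "AE w in P2. (\<lambda>k. real (n k) * (g k x w * g k x' w)) \<longlonglongrightarrow> 0"
      using nonneg2
    proof eventually_elim
      case (elim w)
      show ?case using tendsto_mult[OF ng_tendsto(1)[OF x elim] g_tendsto_0[OF x' elim]] by (simp add: mult.assoc)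
    qed
    show "AE w in P2. norm (real (n k) * (g k x w * g k x' w)) \<le> C * (x * w)" for k
      using nonneg2
    proof eventually_elim
      case (elim w)
      have "real (n k) * g k x w * g k x' w \<le> C * (x * w) * 1"
        using C(1) x elim by (intro mult_mono ng_le g01 mult_nonneg_nonneg) auto
      then show ?case by (simp add: g01 mult.assoc)
    qed
  qed simp_all
  then show ?thesis by simp
qed

section \<open>Concentration of the product over the vertices\<close>

lemma Q01: "0 \<le> Q k x z" "Q k x z \<le> 1"
proof -
  have "0 \<le> 1 - (1 - s) * g k x w" "1 - (1 - s) * g k x w \<le> 1" for w
    using s g01[of k x w] mult_nonneg_nonneg[of "1 - s" "g k x w"] mult_le_one[of "1 - s" "g k x w"] by auto
  then show "0 \<le> Q k x z" "Q k x z \<le> 1" unfolding Q_def by (auto intro!: prod_nonneg prod_le_1)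
qed

lemma Q_meas: "f \<in> borel_measurable M \<Longrightarrow> h \<in> measurable M (Z k) \<Longrightarrow> (\<lambda>u. Q k (f u) (h u)) \<in> borel_measurable M"
proof -
  assume f: "f \<in> borel_measurable M" and h: "h \<in> measurable M (Z k)"
  have "(\<lambda>u. h u v) \<in> borel_measurable M" if "v \<in> {2..n k}" for v
    by (subst measurable_cong_sets[OF refl P2.events_eq_borel[symmetric]])
      (rule measurable_compose[OF h[unfolded Z_def] measurable_component_singleton[OF that]])
  then show ?thesis
    unfolding Q_def
    by (intro borel_measurable_prod borel_measurable_diff borel_measurable_times borel_measurable_const g_comp f)
qed

lemma n_minus_1: "filterlim (\<lambda>k. n k - 1) at_top sequentially"
  by (rule filterlim_compose[OF filterlim_minus_const_nat_at_top n])

lemma mean_Q_power: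
  fixes r :: nat
  assumes "1 \<le> r"
  shows "(\<integral>z. Q k x z ^ r \<partial>Z k) = (\<integral>w. (1 - (1 - s) * g k x w) ^ r \<partial>P2) ^ (n k - 1)"
proof -
  interpret S: product_sigma_finite "\<lambda>_. P2" ..
  have "\<bar>(1 - (1 - s) * g k x w) ^ r\<bar> \<le> 1" for w
    using s g01[of k x w] mult_nonneg_nonneg[of "1 - s" "g k x w"] mult_le_one[of "1 - s" "g k x w"]
    by (auto intro!: power_le_one simp: power_abs)
  then have "integrable P2 (\<lambda>w. (1 - (1 - s) * g k x w) ^ r)"
    by (intro P2.integrable_bounded[where C = 1]) simp_all
  then have "(\<integral>z. (\<Prod>v\<in>{2..n k}. (1 - (1 - s) * g k x (z v)) ^ r) \<partial>Z k) =
      (\<Prod>v\<in>{2..n k}. \<integral>w. (1 - (1 - s) * g k x w) ^ r \<partial>P2)"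
    unfolding Z_def by (intro S.product_integral_prod) auto
  then show ?thesis by (simp add: Q_def prod_power_distrib numeral_2_eq_2)
qed

text \<open>Both moments are powers of one-dimensional integrals. In \<open>(1 - t * g)^2\<close>
  the term quadratic in \<open>g\<close> is negligible even after multiplication by
  \<open>n\<close>, so the exponent of the second moment is exactly twice that of the first.\<close>

lemma mean_Q_tendsto:
  assumes x: "0 \<le> x"
  shows "(\<lambda>k. \<integral>z. Q k x z \<partial>Z k) \<longlonglongrightarrow> q x" "(\<lambda>k. \<integral>z. (Q k x z)\<^sup>2 \<partial>Z k) \<longlonglongrightarrow> (q x)\<^sup>2"
proof -
  let ?t = "1 - s"
  let ?G = "\<lambda>k. \<integral>w. g k x w \<partial>P2" and ?GG = "\<lambda>k. \<integral>w. g k x w * g k x w \<partial>P2"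
  have ig: "integrable P2 (\<lambda>w. g k x w)" "integrable P2 (\<lambda>w. g k x w * g k x w)" for k
    using g01 by (intro P2.integrable_bounded[where C = 1]; simp add: mult_le_one)+
  have t: "0 \<le> ?t" "?t \<le> 1" using s by auto
  have pow: "(\<lambda>k. (1 - u k) ^ (n k - 1)) \<longlonglongrightarrow> exp (- l)"
    if u: "\<And>k. 0 \<le> u k \<and> u k \<le> 1" and l: "(\<lambda>k. real (n k) * u k) \<longlonglongrightarrow> l" for u l
  proof (rule tendsto_one_minus_power_exp[OF n_minus_1])
    have invn: "(\<lambda>k. inverse (real (n k))) \<longlonglongrightarrow> 0"
      by (intro tendsto_inverse_0_at_top filterlim_compose[OF filterlim_real_sequentially n])
    have ev: "eventually (\<lambda>k. 1 \<le> n k) sequentially" using n by (simp add: filterlim_at_top)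
    \<comment> \<open>The exponent is \<open>n - 1\<close> whereas the rate is known for
      \<open>n\<close>; the difference is \<open>(n * u) / n\<close> and vanishes.\<close>
    have "(\<lambda>k. real (n k) * u k - (real (n k) * u k) * inverse (real (n k))) \<longlonglongrightarrow> l - l * 0"
      by (intro tendsto_intros l invn)
    then have "(\<lambda>k. real (n k) * u k - (real (n k) * u k) * inverse (real (n k))) \<longlonglongrightarrow> l" by simp
    then show "(\<lambda>k. real (n k - 1) * u k) \<longlonglongrightarrow> l"
      by (rule Lim_transform_eventually[OF _ eventually_mono[OF ev]]) (auto simp: of_nat_diff field_simps)
  qed (use u in auto)
  have e1: "(\<integral>w. (1 - ?t * g k x w) ^ 1 \<partial>P2) = 1 - ?t * ?G k" for k
    using ig by (simp add: P2.prob_space[unfolded P2.space_eq_univ])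
  have e2: "(\<integral>w. (1 - ?t * g k x w) ^ 2 \<partial>P2) = 1 - (2 * ?t * ?G k - ?t\<^sup>2 * ?GG k)" for k
  proof -
    have "(1 - ?t * g k x w) ^ 2 = 1 - (2 * ?t * g k x w - ?t\<^sup>2 * (g k x w * g k x w))" for w
      by (simp add: power2_eq_square algebra_simps)
    then show ?thesis using ig by (simp add: P2.prob_space[unfolded P2.space_eq_univ])
  qed
  have G01: "0 \<le> ?G k" "?G k \<le> 1" for k
    using g01 P2.abs_integral_le[of "\<lambda>w. g k x w" 1] by auto
  have gt: "0 \<le> 1 - ?t * g k x w" "1 - ?t * g k x w \<le> 1" for k w
    using t g01[of k x w] mult_nonneg_nonneg[of "1 - s" "g k x w"] mult_le_one[of "1 - s" "g k x w"] by auto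
  have u1: "0 \<le> ?t * ?G k \<and> ?t * ?G k \<le> 1" for k
    using G01[of k] t by (auto intro: mult_le_one)
  \<comment> \<open>By \<open>e2\<close>, one minus this quantity is the mean of the square of a
    number in [0, 1].\<close>
  have u2: "0 \<le> 2 * ?t * ?G k - ?t\<^sup>2 * ?GG k \<and> 2 * ?t * ?G k - ?t\<^sup>2 * ?GG k \<le> 1" for k
  proof -
    have "\<bar>(1 - ?t * g k x w) ^ 2\<bar> \<le> 1" for w using gt[of k w] by (simp add: power_le_one)
    then have "\<bar>\<integral>w. (1 - ?t * g k x w) ^ 2 \<partial>P2\<bar> \<le> 1" by (rule P2.abs_integral_le)
    moreover have "0 \<le> (\<integral>w. (1 - ?t * g k x w) ^ 2 \<partial>P2)" by simp
    ultimately show ?thesis unfolding e2 by linarith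
  qed
  have "(\<lambda>k. real (n k) * (?t * ?G k)) \<longlonglongrightarrow> ?t * (x * b1 / sqrt \<beta>)"
    using tendsto_mult_left[OF n_integral_g[OF x], of ?t] by (simp add: ac_simps)
  from pow[OF u1 this] show "(\<lambda>k. \<integral>z. Q k x z \<partial>Z k) \<longlonglongrightarrow> q x"
    using mean_Q_power[of 1 _ x] unfolding e1 by (simp add: q_def)
  have "(\<lambda>k. 2 * ?t * (real (n k) * ?G k) - ?t\<^sup>2 * (real (n k) * ?GG k)) \<longlonglongrightarrow> 2 * ?t * (x * b1 / sqrt \<beta>) - ?t\<^sup>2 * 0"
    by (intro tendsto_intros n_integral_g n_integral_gg x)
  moreover have "2 * ?t * (real (n k) * ?G k) - ?t\<^sup>2 * (real (n k) * ?GG k) = real (n k) * (2 * ?t * ?G k - ?t\<^sup>2 * ?GG k)" for k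
    by (simp add: algebra_simps)
  moreover have "2 * ?t * (x * b1 / sqrt \<beta>) - ?t\<^sup>2 * 0 = 2 * (?t * (x * b1 / sqrt \<beta>))" by simp
  ultimately have "(\<lambda>k. real (n k) * (2 * ?t * ?G k - ?t\<^sup>2 * ?GG k)) \<longlonglongrightarrow> 2 * (?t * (x * b1 / sqrt \<beta>))"
    by (simp only:)
  from pow[OF u2 this] have "(\<lambda>k. \<integral>z. (Q k x z)\<^sup>2 \<partial>Z k) \<longlonglongrightarrow> exp (- (2 * (?t * (x * b1 / sqrt \<beta>))))"
    using mean_Q_power[of 2 _ x] unfolding e2 by simp
  also have "exp (- (2 * (?t * (x * b1 / sqrt \<beta>)))) = (q x)\<^sup>2"
    by (simp add: q_def power2_eq_square exp_add[symmetric])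
  finally show "(\<lambda>k. \<integral>z. (Q k x z)\<^sup>2 \<partial>Z k) \<longlonglongrightarrow> (q x)\<^sup>2" .
qed

lemma b1_nonneg: "0 \<le> b1"
  unfolding b1_def using nonneg2 by (rule integral_nonneg_AE)

lemma q01: "0 \<le> x \<Longrightarrow> 0 \<le> q x" "0 \<le> x \<Longrightarrow> q x \<le> 1"
  using b1_nonneg s beta by (auto simp: q_def)

text \<open>
  The second moment of \<open>Q\<close> over \<open>z\<close> is again an \<open>(n - 1)\<close>-st power of a one-dimensional integral, so
  concentration of \<open>Q\<close> follows from first moments of the weights, without a law of large numbers.
\<close>

lemma Q_L1_tendsto:
  assumes x: "0 \<le> x"
  shows "(\<lambda>k. \<integral>z. \<bar>Q k x z - q x\<bar> \<partial>Z k) \<longlonglongrightarrow> 0"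
proof (rule tendsto_sandwich[OF _ _ tendsto_const])
  \<comment> \<open>The mean square distance of \<open>Q\<close> to the constant \<open>q x\<close>,
    expanded into moments; its limit is \<open>q^2 - 2 * q^2 + q^2\<close>.\<close>
  let ?v = "\<lambda>k. (\<integral>z. (Q k x z)\<^sup>2 \<partial>Z k) - 2 * q x * (\<integral>z. Q k x z \<partial>Z k) + (q x)\<^sup>2"
  have "(\<lambda>k. sqrt (?v k)) \<longlonglongrightarrow> sqrt ((q x)\<^sup>2 - 2 * q x * q x + (q x)\<^sup>2)"
    by (intro tendsto_intros mean_Q_tendsto x)
  then show "(\<lambda>k. sqrt (?v k)) \<longlonglongrightarrow> 0" by (simp add: power2_eq_square)
  show "eventually (\<lambda>k. (\<integral>z. \<bar>Q k x z - q x\<bar> \<partial>Z k) \<le> sqrt (?v k)) sequentially"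
  proof (intro always_eventually allI)
    fix k
    have Qm: "Q k x \<in> borel_measurable (Z k)" by (rule Q_meas[of "\<lambda>_. x"]) simp_all
    have Qi: "integrable (Z k) (Q k x)" "integrable (Z k) (\<lambda>z. (Q k x z)\<^sup>2)"
      using Q01[of k x] Qm by (auto intro!: Z.integrable_bounded[where C = 1] simp: power_le_one)
    have "\<bar>Q k x z - q x\<bar> \<le> 1" for z using Q01[of k x z] q01[OF x] by linarith
    then have "(\<integral>z. \<bar>Q k x z - q x\<bar> \<partial>Z k) \<le> sqrt (\<integral>z. (Q k x z - q x)\<^sup>2 \<partial>Z k)"
      using Qm by (intro Z.expectation_abs_le_sqrt) auto
    also have "(\<integral>z. (Q k x z - q x)\<^sup>2 \<partial>Z k) = (\<integral>z. (Q k x z)\<^sup>2 - 2 * q x * Q k x z + (q x)\<^sup>2 \<partial>Z k)"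
      by (simp add: power2_eq_square algebra_simps)
    also have "\<dots> = ?v k" using Qi by (simp add: Z.prob_space)
    finally show "(\<integral>z. \<bar>Q k x z - q x\<bar> \<partial>Z k) \<le> sqrt (?v k)" .
  qed
qed (auto intro!: always_eventually)

text \<open>
  Given the weight \<open>y\<close> of vertex 1 and the weights \<open>z\<close> of the others, \<open>(1 - phi k y z) ^ m k\<close> is the
  generating function of the number of paths of length two from vertex 1.
\<close>

definition phi :: "nat \<Rightarrow> real \<Rightarrow> (nat \<Rightarrow> real) \<Rightarrow> real" where
  "phi k y z = (\<integral>x. g k x y * (1 - Q k x z) \<partial>P1)"
text \<open>The exponent of the limit law given the weight \<open>y\<close>:
  \<open>sqrt \<beta> * x * y\<close> is the limiting rate of attributes of weight \<open>x\<close>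
  at vertex 1, and \<open>1 - q x\<close> is what each of them removes from the generating
  function.\<close>

definition psi :: "real \<Rightarrow> real" where
  "psi y = sqrt \<beta> * y * (\<integral>x. x * (1 - q x) \<partial>P1)"

lemma q_meas[measurable]: "q \<in> borel_measurable borel"
  unfolding q_def by measurable

lemma phi_meas: "f \<in> borel_measurable M \<Longrightarrow> h \<in> measurable M (Z k) \<Longrightarrow> (\<lambda>u. phi k (f u) (h u)) \<in> borel_measurable M"
proof -
  assume f: "f \<in> borel_measurable M" and h: "h \<in> measurable M (Z k)"
  have "(\<lambda>(u, x). g k x (f u) * (1 - Q k x (h u))) \<in> borel_measurable (M \<Otimes>\<^sub>M P1)"
    unfolding case_prod_unfold
    by (intro borel_measurable_times borel_measurable_diff borel_measurable_const g_comp Q_meas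
        measurable_compose[OF measurable_fst f] measurable_compose[OF measurable_fst h]) measurable
  then show ?thesis unfolding phi_def by (rule P1.borel_measurable_lebesgue_integral)
qed

lemma gQ01: "0 \<le> g k x y * (1 - Q k x z)" "g k x y * (1 - Q k x z) \<le> 1"
proof -
  have "0 \<le> 1 - Q k x z" "1 - Q k x z \<le> 1" using Q01[of k x z] by auto
  then show "0 \<le> g k x y * (1 - Q k x z)" "g k x y * (1 - Q k x z) \<le> 1"
    using g01[of k x y] by (auto intro: mult_le_one)
qed

lemma gQ_integrable: "z \<in> space (Z k) \<Longrightarrow> integrable P1 (\<lambda>x. g k x y * (1 - Q k x z))"
proof (rule P1.integrable_bounded[where C = 1])
  assume "z \<in> space (Z k)"
  then show "(\<lambda>x. g k x y * (1 - Q k x z)) \<in> borel_measurable P1"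
    by (intro borel_measurable_times borel_measurable_diff borel_measurable_const g_comp Q_meas) simp_all
  show "\<bar>g k x y * (1 - Q k x z)\<bar> \<le> 1" for x using gQ01[of k x y z] by simp
qed

lemma phi01: "0 \<le> phi k y z" "phi k y z \<le> 1"
proof -
  have "\<bar>phi k y z\<bar> \<le> 1" unfolding phi_def
    by (rule P1.abs_integral_le) (use gQ01[of k _ y z] in simp)
  then show "phi k y z \<le> 1" by simp
  show "0 \<le> phi k y z" unfolding phi_def using gQ01 by simp
qed

lemma int_xq: "integrable P1 (\<lambda>x. x * (1 - q x))"
proof (rule Bochner_Integration.integrable_bound[OF int1])
  show "AE x in P1. norm (x * (1 - q x)) \<le> norm x"
    using nonneg1
  proof eventually_elim
    case (elim x)
    have "x * (1 - q x) \<le> x * 1" using q01[OF elim] elim by (intro mult_left_mono) auto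
    then show ?case using q01[OF elim] elim by (simp add: abs_mult)
  qed
qed measurable

lemma psi_nonneg: "0 \<le> y \<Longrightarrow> 0 \<le> psi y"
proof -
  assume y: "0 \<le> y"
  have "0 \<le> (\<integral>x. x * (1 - q x) \<partial>P1)"
    using nonneg1 by (intro integral_nonneg_AE) (auto elim!: eventually_mono simp: q01)
  then show ?thesis unfolding psi_def using y beta by simp
qed

text \<open>\<open>Q\<close> concentrates at fixed \<open>x\<close>, while \<open>phi\<close>
  integrates over \<open>x\<close> at fixed \<open>z\<close>. Bounding the difference under the
  \<open>x\<close>-integral and exchanging the two integrals gives the mean of |Q - q| over
  \<open>z\<close> at each \<open>x\<close>, and dominated convergence in \<open>x\<close>
  finishes.\<close>

lemma m_phi_L1_tendsto:
  assumes y: "0 \<le> y"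
  shows "(\<lambda>k. \<integral>z. \<bar>real (m k) * phi k y z - psi y\<bar> \<partial>Z k) \<longlonglongrightarrow> 0"
proof (rule tendsto_sandwich[OF _ _ tendsto_const])
  let ?e = "\<lambda>k x. \<integral>z. \<bar>Q k x z - q x\<bar> \<partial>Z k"
  let ?h = "\<lambda>k x. \<bar>real (m k) * g k x y - sqrt \<beta> * (x * y)\<bar> + real (m k) * g k x y * ?e k x"
  have Qabs: "\<bar>Q k x z - q x\<bar> \<le> 1" if "0 \<le> x" for k x z using Q01[of k x z] q01[OF that] by linarith
  have e01: "0 \<le> ?e k x" "?e k x \<le> 1" if "0 \<le> x" for k x
    using Z.abs_integral_le[of "\<lambda>z. \<bar>Q k x z - q x\<bar>" 1 k] Qabs[OF that] by auto
  have e_meas: "?e k \<in> borel_measurable P1" for k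
  proof (rule Z.borel_measurable_lebesgue_integral)
    have "(\<lambda>u. Q k (fst u) (snd u)) \<in> borel_measurable (P1 \<Otimes>\<^sub>M Z k)" by (intro Q_meas) measurable
    then show "(\<lambda>(x, z). \<bar>Q k x z - q x\<bar>) \<in> borel_measurable (P1 \<Otimes>\<^sub>M Z k)"
      unfolding case_prod_unfold by measurable
  qed
  have h_meas: "?h k \<in> borel_measurable P1" for k using e_meas[of k] by measurable
  \<comment> \<open>The outer terms bound the edge rate, once alone and once multiplied by a mean of
    |Q - q| that is at most 1; the middle term is the limiting rate.\<close>
  let ?w = "\<lambda>x. (C * y + sqrt \<beta> * y + C * y) * x"
  have h_bound: "AE x in P1. norm (?h k x) \<le> ?w x" for k
    using nonneg1
  proof eventually_elim
    case (elim x)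
    have 1: "real (m k) * g k x y \<le> C * (x * y)" by (rule ng_le[OF elim y])
    have 2: "0 \<le> real (m k) * g k x y" by (simp add: g01)
    have 3: "real (m k) * g k x y * ?e k x \<le> C * (x * y) * 1"
      by (rule mult_mono[OF 1 e01(2)[OF elim] order_trans[OF 2 1] e01(1)[OF elim]])
    have 4: "0 \<le> sqrt \<beta> * (x * y)" using beta elim y by simp
    have 5: "0 \<le> real (m k) * g k x y * ?e k x" using 2 e01[OF elim, of k] by simp
    have "norm (?h k x) = ?h k x" unfolding real_norm_def using 5 by (intro abs_of_nonneg add_nonneg_nonneg abs_ge_zero)
    also have "\<dots> \<le> C * (x * y) + sqrt \<beta> * (x * y) + C * (x * y)"
      using 1 2 3 4 by linarith
    finally show ?case by (simp add: algebra_simps)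
  qed
  have wint: "integrable P1 ?w" using int1 by simp
  have hint: "integrable P1 (?h k)" for k
    by (rule Bochner_Integration.integrable_bound[OF wint h_meas])
      (use h_bound[of k] in \<open>auto elim!: eventually_mono intro: order_trans[OF _ abs_ge_self]\<close>)
  have "(\<lambda>k. \<integral>x. ?h k x \<partial>P1) \<longlonglongrightarrow> (\<integral>x. 0 \<partial>P1)"
  proof (rule integral_dominated_convergence[OF _ h_meas wint _ h_bound])
    show "AE x in P1. (\<lambda>k. ?h k x) \<longlonglongrightarrow> 0"
      using nonneg1
    proof eventually_elim
      case (elim x)
      have "(\<lambda>k. ?h k x) \<longlonglongrightarrow> \<bar>sqrt \<beta> * (x * y) - sqrt \<beta> * (x * y)\<bar> + sqrt \<beta> * (x * y) * 0"
        by (intro tendsto_intros ng_tendsto elim y Q_L1_tendsto)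
      then show ?case by simp
    qed
  qed simp
  then show "(\<lambda>k. \<integral>x. ?h k x \<partial>P1) \<longlonglongrightarrow> 0" by simp
  show "eventually (\<lambda>k. (\<integral>z. \<bar>real (m k) * phi k y z - psi y\<bar> \<partial>Z k) \<le> (\<integral>x. ?h k x \<partial>P1)) sequentially"
  proof (intro always_eventually allI)
    fix k
    let ?f = "\<lambda>x z. \<bar>real (m k) * g k x y - sqrt \<beta> * (x * y)\<bar> + real (m k) * g k x y * \<bar>Q k x z - q x\<bar>"
    interpret P1Z: pair_sigma_finite P1 "Z k" ..
    have Qm: "(\<lambda>u. Q k (fst u) (snd u)) \<in> borel_measurable (P1 \<Otimes>\<^sub>M Z k)" by (intro Q_meas) measurable
    have fm: "(\<lambda>(x, z). ?f x z) \<in> borel_measurable (P1 \<Otimes>\<^sub>M Z k)"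
      using Qm unfolding case_prod_unfold by measurable
    have Qi: "integrable (Z k) (\<lambda>z. \<bar>Q k x z - q x\<bar>)" if "0 \<le> x" for x
      using Qabs[OF that, of k] Q_meas[of "\<lambda>_. x" "Z k" "\<lambda>z. z" k]
      by (intro Z.integrable_bounded[where C = 1]) auto
    have fi_h: "(\<integral>z. ?f x z \<partial>Z k) = ?h k x" if "0 \<le> x" for x
      using Qi[OF that] by (simp add: Z.prob_space)
    have f0: "0 \<le> ?f x z" for x z by (simp add: g01)
    have nf: "norm (case (x, z) of (x, z) \<Rightarrow> ?f x z) = ?f x z" for x z
      unfolding prod.case real_norm_def by (rule abs_of_nonneg[OF f0])
    \<comment> \<open>For negative \<open>x\<close> the value \<open>q x\<close> may exceed 1, so
      boundedness is available only almost everywhere; integrability on the product is obtained from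
      the iterated integral \<open>?h\<close>.\<close>
    have fint: "integrable (P1 \<Otimes>\<^sub>M Z k) (\<lambda>(x, z). ?f x z)"
    proof (rule P1Z.Fubini_integrable[OF fm])
      have "AE x in P1. ?h k x = (\<integral>z. norm (case (x, z) of (x, z) \<Rightarrow> ?f x z) \<partial>Z k)"
        using nonneg1 by eventually_elim (simp only: nf fi_h)
      moreover have "(\<lambda>x. \<integral>z. norm (case (x, z) of (x, z) \<Rightarrow> ?f x z) \<partial>Z k) \<in> borel_measurable P1"
        using fm by (intro Z.borel_measurable_lebesgue_integral) (simp add: case_prod_unfold)
      ultimately show "integrable P1 (\<lambda>x. \<integral>z. norm (case (x, z) of (x, z) \<Rightarrow> ?f x z) \<partial>Z k)"
        using hint[of k] h_meas[of k] by (subst (asm) integrable_cong_AE) auto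
      show "AE x in P1. integrable (Z k) (\<lambda>z. case (x, z) of (x, z) \<Rightarrow> ?f x z)"
        using nonneg1 by eventually_elim (use Qi in simp)
    qed
    have f_ge: "AE x in P1. \<bar>real (m k) * (g k x y * (1 - Q k x z)) - sqrt \<beta> * y * (x * (1 - q x))\<bar> \<le> ?f x z" for z
      using nonneg1
      by (rule eventually_mono)
        (rule abs_rate_diff_le[OF mult_nonneg_nonneg[OF of_nat_0_le_iff g01(1)] q01(1) q01(2)])
    have "(\<integral>z. \<bar>real (m k) * phi k y z - psi y\<bar> \<partial>Z k) \<le> (\<integral>z. \<integral>x. ?f x z \<partial>P1 \<partial>Z k)"
    proof (rule integral_mono_AE')
      show "integrable (Z k) (\<lambda>z. \<integral>x. ?f x z \<partial>P1)"
        using P1Z.integrable_snd[OF fint] by simp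
      have "AE z in Z k. integrable P1 (\<lambda>x. ?f x z)"
        using P1Z.AE_integrable_snd[OF fint] by simp
      moreover have "AE z in Z k. z \<in> space (Z k)" by simp
      ultimately show "AE z in Z k. \<bar>real (m k) * phi k y z - psi y\<bar> \<le> (\<integral>x. ?f x z \<partial>P1)"
      proof eventually_elim
        fix z assume z: "z \<in> space (Z k)" and fi: "integrable P1 (\<lambda>x. ?f x z)"
        have i1: "integrable P1 (\<lambda>x. real (m k) * (g k x y * (1 - Q k x z)))"
          using gQ_integrable[OF z] by simp
        have i2: "integrable P1 (\<lambda>x. sqrt \<beta> * y * (x * (1 - q x)))" using int_xq by simp
        have eq: "real (m k) * phi k y z - psi y =
            (\<integral>x. real (m k) * (g k x y * (1 - Q k x z)) - sqrt \<beta> * y * (x * (1 - q x)) \<partial>P1)"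
          using i1 i2 by (simp add: phi_def psi_def)
        have "\<bar>real (m k) * phi k y z - psi y\<bar> \<le> (\<integral>x. \<bar>real (m k) * (g k x y * (1 - Q k x z)) - sqrt \<beta> * y * (x * (1 - q x))\<bar> \<partial>P1)"
          unfolding eq by (rule integral_abs_bound)
        also have "\<dots> \<le> (\<integral>x. ?f x z \<partial>P1)"
          by (rule integral_mono_AE[OF integrable_abs[OF Bochner_Integration.integrable_diff[OF i1 i2]] fi f_ge])
        finally show "\<bar>real (m k) * phi k y z - psi y\<bar> \<le> (\<integral>x. ?f x z \<partial>P1)" .
      qed
      show "AE z in Z k. 0 \<le> (\<integral>x. ?f x z \<partial>P1)" using f0 by simp
    qed
    also have "\<dots> = (\<integral>x. \<integral>z. ?f x z \<partial>Z k \<partial>P1)"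
      using P1Z.Fubini_integral[OF fint] by simp
    also have "\<dots> = (\<integral>x. ?h k x \<partial>P1)"
    proof (rule integral_cong_AE)
      show "AE x in P1. (\<integral>z. ?f x z \<partial>Z k) = ?h k x" using nonneg1 by eventually_elim (rule fi_h)
      show "(\<lambda>x. \<integral>z. ?f x z \<partial>Z k) \<in> borel_measurable P1"
        using fm by (rule Z.borel_measurable_lebesgue_integral)
    qed (rule h_meas)
    finally show "(\<integral>z. \<bar>real (m k) * phi k y z - psi y\<bar> \<partial>Z k) \<le> (\<integral>x. ?h k x \<partial>P1)" .
  qed
qed (auto intro!: always_eventually)

text \<open>The comparison is with the deterministic power \<open>(1 - psi y / m)^m\<close>. Since
  |a^m - b^m| \<le> m |a - b|, the difference is at most the mean of |m phi - psi|, so convergence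
  in mean is enough.\<close>

lemma power_phi_tendsto:
  assumes y: "0 \<le> y"
  shows "(\<lambda>k. \<integral>z. (1 - phi k y z) ^ m k \<partial>Z k) \<longlonglongrightarrow> exp (- psi y)"
proof -
  have invm: "(\<lambda>k. inverse (real (m k))) \<longlonglongrightarrow> 0"
    by (intro tendsto_inverse_0_at_top filterlim_compose[OF filterlim_real_sequentially m])
  \<comment> \<open>\<open>norm_power_diff\<close> needs bases of norm at most 1; for
    \<open>1 - psi y / m\<close> this is ensured once \<open>m k\<close> is at least
    \<open>psi y\<close>.\<close>
  have ev: "eventually (\<lambda>k. 1 \<le> m k \<and> psi y / real (m k) \<le> 1) sequentially"
  proof -
    have "eventually (\<lambda>k. max 1 (nat \<lceil>psi y\<rceil>) \<le> m k) sequentially"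
      using m by (auto simp: filterlim_at_top simp del: max.bounded_iff)
    then show ?thesis
    proof eventually_elim
      case (elim k)
      then have "1 \<le> m k" "psi y \<le> real (m k)" by (auto simp: nat_le_iff ceiling_le_iff)
      then show ?case by (simp add: divide_le_eq)
    qed
  qed
  have lim: "(\<lambda>k. (1 - psi y / real (m k)) ^ m k) \<longlonglongrightarrow> exp (- psi y)"
  proof (rule tendsto_one_minus_power_exp[OF m])
    show "eventually (\<lambda>k. 0 \<le> psi y / real (m k) \<and> psi y / real (m k) \<le> 1) sequentially"
      using ev by eventually_elim (simp add: psi_nonneg[OF y])
    show "(\<lambda>k. real (m k) * (psi y / real (m k))) \<longlonglongrightarrow> psi y"
      by (rule Lim_transform_eventually[OF tendsto_const]) (rule eventually_mono[OF ev], auto)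
  qed
  have "eventually (\<lambda>k. norm ((\<integral>z. (1 - phi k y z) ^ m k \<partial>Z k) - (1 - psi y / real (m k)) ^ m k)
      \<le> (\<integral>z. \<bar>real (m k) * phi k y z - psi y\<bar> \<partial>Z k)) sequentially"
    using ev
  proof eventually_elim
    case (elim k)
    have pm: "(\<lambda>z. phi k y z) \<in> borel_measurable (Z k)" by (rule phi_meas) simp_all
    have int: "integrable (Z k) (\<lambda>z. (1 - phi k y z) ^ m k)"
      using pm phi01 by (intro Z.integrable_bounded[where C = 1]) (auto simp: power_abs intro!: power_le_one)
    have int2: "integrable (Z k) (\<lambda>z. \<bar>real (m k) * phi k y z - psi y\<bar>)"
    proof -
      have "integrable (Z k) (phi k y)"
        using pm phi01 by (intro Z.integrable_bounded[where C = 1]) auto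
      then show ?thesis by simp
    qed
    have "norm ((\<integral>z. (1 - phi k y z) ^ m k \<partial>Z k) - (1 - psi y / real (m k)) ^ m k)
        = \<bar>\<integral>z. (1 - phi k y z) ^ m k - (1 - psi y / real (m k)) ^ m k \<partial>Z k\<bar>"
      using int by (simp add: Z.prob_space)
    also have "\<dots> \<le> (\<integral>z. \<bar>(1 - phi k y z) ^ m k - (1 - psi y / real (m k)) ^ m k\<bar> \<partial>Z k)"
      by (rule integral_abs_bound)
    also have "\<dots> \<le> (\<integral>z. \<bar>real (m k) * phi k y z - psi y\<bar> \<partial>Z k)"
    proof (rule integral_mono)
      fix z
      have "0 \<le> psi y / real (m k)" using psi_nonneg[OF y] by simp
      then have "norm ((1 - phi k y z) ^ m k - (1 - psi y / real (m k)) ^ m k)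
          \<le> m k * norm ((1 - phi k y z) - (1 - psi y / real (m k)))"
        using phi01[of k y z] elim by (intro norm_power_diff) auto
      also have "\<dots> = \<bar>real (m k) * ((1 - phi k y z) - (1 - psi y / real (m k)))\<bar>"
        by (simp add: abs_mult)
      also have "real (m k) * ((1 - phi k y z) - (1 - psi y / real (m k))) = - (real (m k) * phi k y z - psi y)"
        using elim by (simp add: field_simps)
      finally show "\<bar>(1 - phi k y z) ^ m k - (1 - psi y / real (m k)) ^ m k\<bar> \<le> \<bar>real (m k) * phi k y z - psi y\<bar>"
        by simp
    qed (use int int2 in auto)
    finally show ?case .
  qed
  from Lim_null_comparison[OF this m_phi_L1_tendsto[OF y]]
  have "(\<lambda>k. (\<integral>z. (1 - phi k y z) ^ m k \<partial>Z k) - (1 - psi y / real (m k)) ^ m k) \<longlonglongrightarrow> 0" .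
  from tendsto_add[OF this lim] show ?thesis by simp
qed

text \<open>A bound for the probability that two given attributes are both joined to vertex 1, of
  weight \<open>y\<close>, and to a common further vertex.\<close>

definition T :: "nat \<Rightarrow> real \<Rightarrow> real" where
  "T k y = (\<integral>x'. \<integral>x. g k x y * g k x' y * min 1 (real (n k) * (\<integral>w. g k x w * g k x' w \<partial>P2)) \<partial>P1 \<partial>P1)"

text \<open>
  The inner truncation at 1 gives the integrable dominating function \<open>x * x'\<close>; without it the
  bound would need second moments of \<open>P1\<close>.
\<close>

lemma T_tendsto:
  assumes y: "0 \<le> y"
  shows "(\<lambda>k. (real (m k))\<^sup>2 * T k y) \<longlonglongrightarrow> 0"
proof -
  let ?K = "\<lambda>k x x'. min 1 (real (n k) * (\<integral>w. g k x w * g k x' w \<partial>P2))"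
  let ?I = "\<lambda>k x'. \<integral>x. real (m k) * g k x y * ?K k x x' \<partial>P1"
  have K01: "0 \<le> ?K k x x'" "?K k x x' \<le> 1" for k x x' by (simp_all add: g01)
  have K_meas': "(\<lambda>x. ?K k x x') \<in> borel_measurable borel" for k x' by measurable
  have I_meas: "?I k \<in> borel_measurable P1" for k by measurable
  have bound: "AE x in P1. norm (real (m k) * g k x y * ?K k x x') \<le> C * (x * y)" for k x'
    using nonneg1
  proof eventually_elim
    case (elim x)
    have "real (m k) * g k x y * ?K k x x' \<le> C * (x * y) * 1"
      using C(1) elim y K01[of k x x'] by (intro mult_mono ng_le) auto
    then show ?case using K01[of k x x'] g01[of k x y] by (simp add: abs_mult)
  qed
  have wint: "integrable P1 (\<lambda>x. C * (x * y))" using int1 by simp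
  \<comment> \<open>The two integrals are handled one at a time, each absorbing one factor
    \<open>m\<close>. At fixed \<open>x'\<close> the truncated kernel tends to 0; afterwards
    \<open>?a\<close> bounds the inner integral uniformly in \<open>k\<close> and
    \<open>x'\<close>.\<close>
  have I_lim: "(\<lambda>k. ?I k x') \<longlonglongrightarrow> 0" if x': "0 \<le> x'" for x'
  proof -
    have "(\<lambda>k. ?I k x') \<longlonglongrightarrow> (\<integral>x. 0 \<partial>P1)"
    proof (rule integral_dominated_convergence[OF _ _ wint _ bound])
      show "AE x in P1. (\<lambda>k. real (m k) * g k x y * ?K k x x') \<longlonglongrightarrow> 0"
        using nonneg1
      proof eventually_elim
        case (elim x)
        have "(\<lambda>k. real (m k) * g k x y * ?K k x x') \<longlonglongrightarrow> sqrt \<beta> * (x * y) * min 1 0"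
          by (intro tendsto_intros ng_tendsto n_integral_gg elim y x')
        then show ?case by simp
      qed
    qed (use K_meas' in measurable)
    then show ?thesis by simp
  qed
  let ?a = "\<integral>x. C * (x * y) \<partial>P1"
  have I01: "0 \<le> ?I k x'" "?I k x' \<le> ?a" for k x'
  proof -
    show "0 \<le> ?I k x'" using K01 g01 by simp
    have i: "integrable P1 (\<lambda>x. real (m k) * g k x y * ?K k x x')"
      using K_meas'[of k x'] wint
      by (rule_tac Bochner_Integration.integrable_bound[OF wint], measurable)
        (use bound[of k x'] in \<open>auto elim!: eventually_mono intro: order_trans[OF _ abs_ge_self]\<close>)
    show "?I k x' \<le> ?a"
      using bound[of k x'] by (intro integral_mono_AE i wint) (auto elim!: eventually_mono)
  qed
  have "(\<lambda>k. \<integral>x'. real (m k) * g k x' y * ?I k x' \<partial>P1) \<longlonglongrightarrow> (\<integral>x'. 0 \<partial>P1)"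
  proof (rule integral_dominated_convergence[where w = "\<lambda>x. C * (x * y) * ?a"])
    show "integrable P1 (\<lambda>x. C * (x * y) * ?a)" using int1 by simp
    show "AE x' in P1. (\<lambda>k. real (m k) * g k x' y * ?I k x') \<longlonglongrightarrow> 0"
      using nonneg1
    proof eventually_elim
      case (elim x')
      from tendsto_mult[OF ng_tendsto(2)[OF elim y] I_lim[OF elim]] show ?case by simp
    qed
    show "AE x' in P1. norm (real (m k) * g k x' y * ?I k x') \<le> C * (x' * y) * ?a" for k
      using nonneg1
    proof eventually_elim
      case (elim x')
      have "real (m k) * g k x' y * ?I k x' \<le> C * (x' * y) * ?a"
        using C(1) elim y I01[of k x'] by (intro mult_mono ng_le mult_nonneg_nonneg) auto
      moreover have "0 \<le> real (m k) * g k x' y * ?I k x'"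
        using I01[of k x'] g01[of k x' y] by (intro mult_nonneg_nonneg) auto
      ultimately show ?case by simp
    qed
    show "(\<lambda>x'. real (m k) * g k x' y * ?I k x') \<in> borel_measurable P1" for k
      using I_meas[of k] by measurable
  qed simp
  moreover have "(real (m k))\<^sup>2 * T k y = (\<integral>x'. real (m k) * g k x' y * ?I k x' \<partial>P1)" for k
    unfolding T_def by (simp add: power2_eq_square ac_simps flip: integral_mult_right_zero)
  ultimately show ?thesis by simp
qed

text \<open>All limits are known at fixed \<open>y\<close>. The main term and the truncated error
  are both bounded by 1, so a constant dominates the remaining average over
  \<open>P2\<close>.\<close>

lemma pgf_degree_tendsto:
  "(\<lambda>k. \<integral>G. s ^ vertex_degree G 1 \<partial>random_intersection_graph P1 P2 (n k) (m k)) \<longlonglongrightarrow> (\<integral>y. exp (- psi y) \<partial>P2)"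
proof -
  let ?L = "\<lambda>k. \<integral>G. s ^ vertex_degree G 1 \<partial>random_intersection_graph P1 P2 (n k) (m k)"
  let ?W = "\<lambda>k. \<integral>y. \<integral>z. (1 - phi k y z) ^ m k \<partial>Z k \<partial>P2"
  have main: "?W \<longlonglongrightarrow> (\<integral>y. exp (- psi y) \<partial>P2)"
  proof (rule integral_dominated_convergence[where w = "\<lambda>_. 1"])
    show "AE y in P2. (\<lambda>k. \<integral>z. (1 - phi k y z) ^ m k \<partial>Z k) \<longlonglongrightarrow> exp (- psi y)"
      using nonneg2 by eventually_elim (rule power_phi_tendsto)
    show "AE y in P2. norm (\<integral>z. (1 - phi k y z) ^ m k \<partial>Z k) \<le> 1" for k
    proof (intro AE_I2)
      fix y
      have "\<bar>(1 - phi k y z) ^ m k\<bar> \<le> 1" for z using phi01[of k y z] by (auto simp: power_abs intro!: power_le_one)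
      then show "norm (\<integral>z. (1 - phi k y z) ^ m k \<partial>Z k) \<le> 1" unfolding real_norm_def by (rule Z.abs_integral_le)
    qed
    show "(\<lambda>y. \<integral>z. (1 - phi k y z) ^ m k \<partial>Z k) \<in> borel_measurable P2" for k
    proof (rule Z.borel_measurable_lebesgue_integral)
      have "(\<lambda>u. phi k (fst u) (snd u)) \<in> borel_measurable (P2 \<Otimes>\<^sub>M Z k)" by (intro phi_meas) measurable
      then show "(\<lambda>(y, z). (1 - phi k y z) ^ m k) \<in> borel_measurable (P2 \<Otimes>\<^sub>M Z k)"
        unfolding case_prod_unfold by measurable
    qed
    show "(\<lambda>y. exp (- psi y)) \<in> borel_measurable P2" unfolding psi_def by measurable
  qed simp
  have T0: "0 \<le> T k y" for k y unfolding T_def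
    using g01 by (intro Bochner_Integration.integral_nonneg mult_nonneg_nonneg) auto
  have "(\<lambda>k. \<integral>y. min 1 ((real (m k))\<^sup>2 * T k y) \<partial>P2) \<longlonglongrightarrow> (\<integral>y. 0 \<partial>P2)"
  proof (rule integral_dominated_convergence[where w = "\<lambda>_. 1"])
    show "AE y in P2. (\<lambda>k. min 1 ((real (m k))\<^sup>2 * T k y)) \<longlonglongrightarrow> 0"
      using nonneg2
    proof eventually_elim
      case (elim y)
      from tendsto_min[OF tendsto_const T_tendsto[OF elim], of 1] show ?case by simp
    qed
    show "AE y in P2. norm (min 1 ((real (m k))\<^sup>2 * T k y)) \<le> 1" for k using T0 by simp
    have "T k \<in> borel_measurable borel" for k
      unfolding T_def by (rule two_paths_bound_measurable[OF g_meas g01])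
    then show "(\<lambda>y. min 1 ((real (m k))\<^sup>2 * T k y)) \<in> borel_measurable P2" for k by measurable
  qed simp_all
  then have err: "(\<lambda>k. \<integral>y. min 1 ((real (m k))\<^sup>2 * T k y) \<partial>P2) \<longlonglongrightarrow> 0" by simp
  have "eventually (\<lambda>k. norm (?L k - ?W k) \<le> (\<integral>y. min 1 ((real (m k))\<^sup>2 * T k y) \<partial>P2)) sequentially"
  proof -
    have "eventually (\<lambda>k. 1 \<le> n k) sequentially" using n by (simp add: filterlim_at_top)
    then show ?thesis
    proof eventually_elim
      case (elim k)
      have "?W k = (\<integral>y. \<integral>z. (\<integral>x. 1 - g k x y * (1 - (\<Prod>v\<in>{2..n k}. 1 - (1 - s) * g k x (z v))) \<partial>P1) ^ m k \<partial>Z k \<partial>P2)"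
      proof (intro Bochner_Integration.integral_cong refl arg_cong2[where f = "(^)"])
        fix y z assume "z \<in> space (Z k)"
        from gQ_integrable[OF this, of y]
        show "1 - phi k y z = (\<integral>x. 1 - g k x y * (1 - (\<Prod>v\<in>{2..n k}. 1 - (1 - s) * g k x (z v))) \<partial>P1)"
          unfolding phi_def Q_def by (simp add: P1.prob_space[unfolded P1.space_eq_univ])
      qed
      then show ?case
        using pgf_degree_approx[OF elim s, of "m k"] unfolding T_def Z_def g_def by simp
    qed
  qed
  from Lim_null_comparison[OF this err] have "(\<lambda>k. ?L k - ?W k) \<longlonglongrightarrow> 0" .
  from tendsto_add[OF this main] show ?thesis by simp
qed

end

section \<open>The compound mixed Poisson law\<close>

lemma (in prob_space) nn_integral_of_nat_rv:
  fixes X :: "'a \<Rightarrow> nat" and h :: "nat \<Rightarrow> real"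
  assumes [measurable]: "X \<in> measurable M (count_space UNIV)" and h: "\<And>r. 0 \<le> h r"
  shows "(\<integral>\<^sup>+\<omega>. ennreal (h (X \<omega>)) \<partial>M) = (\<Sum>r. ennreal (h r * prob {\<omega> \<in> space M. X \<omega> = r}))"
proof -
  have "ennreal (h (X \<omega>)) = (\<Sum>r. ennreal (h r) * indicator {\<omega> \<in> space M. X \<omega> = r} \<omega>)"
    if "\<omega> \<in> space M" for \<omega>
  proof -
    have "(\<lambda>r. if r = X \<omega> then ennreal (h r) else 0) sums ennreal (h (X \<omega>))" by (rule sums_single)
    moreover have "(\<lambda>r. if r = X \<omega> then ennreal (h r) else 0) = (\<lambda>r. ennreal (h r) * indicator {\<omega> \<in> space M. X \<omega> = r} \<omega>)"
      using that by (auto simp: fun_eq_iff indicator_def)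
    ultimately show ?thesis by (simp add: sums_iff)
  qed
  then have "(\<integral>\<^sup>+\<omega>. ennreal (h (X \<omega>)) \<partial>M) = (\<integral>\<^sup>+\<omega>. (\<Sum>r. ennreal (h r) * indicator {\<omega> \<in> space M. X \<omega> = r} \<omega>) \<partial>M)"
    by (intro nn_integral_cong)
  also have "\<dots> = (\<Sum>r. \<integral>\<^sup>+\<omega>. ennreal (h r) * indicator {\<omega> \<in> space M. X \<omega> = r} \<omega> \<partial>M)"
    by (rule nn_integral_suminf) measurable
  also have "\<dots> = (\<Sum>r. ennreal (h r * prob {\<omega> \<in> space M. X \<omega> = r}))"
    using h by (intro suminf_cong) (simp add: nn_integral_cmult_indicator emeasure_eq_measure ennreal_mult)
  finally show ?thesis .
qed

text \<open>The integrand is split according to the value of the random number of summands. That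
  variable occupies index 0 of the independent family, so each piece is a product over
  \<open>{0..r}\<close> and its mean factorises.\<close>

lemma (in prob_space) nn_integral_power_compound:
  fixes \<Lambda> :: "'a \<Rightarrow> nat" and \<tau> :: "nat \<Rightarrow> 'a \<Rightarrow> nat" and s :: real
  assumes L[measurable]: "\<Lambda> \<in> measurable M (count_space UNIV)"
    and \<tau>: "\<And>j. 1 \<le> j \<Longrightarrow> \<tau> j \<in> measurable M (count_space UNIV)"
    and indep: "indep_vars (\<lambda>_. count_space UNIV) (\<lambda>j. if j = 0 then \<Lambda> else \<tau> j) UNIV"
    and ident: "\<And>j. 1 \<le> j \<Longrightarrow> distr M (count_space UNIV) (\<tau> j) = distr M (count_space UNIV) (\<tau> 1)"
    and s: "0 \<le> s" "s \<le> 1"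
  shows "(\<integral>\<^sup>+\<omega>. ennreal (s ^ (\<Sum>j = 1..\<Lambda> \<omega>. \<tau> j \<omega>)) \<partial>M) =
    (\<Sum>r. ennreal (prob {\<omega> \<in> space M. \<Lambda> \<omega> = r} * expectation (\<lambda>\<omega>. s ^ \<tau> 1 \<omega>) ^ r))"
proof -
  let ?V = "\<lambda>j. if j = 0 then \<Lambda> else \<tau> j"
  \<comment> \<open>Index 0 carries the indicator of the event that there are \<open>r\<close>
    summands; the other indices carry the powers.\<close>
  let ?Y = "\<lambda>r j k. if j = 0 then indicator {r} k else s ^ k :: real"
  have V: "?V j \<in> measurable M (count_space UNIV)" for j using L \<tau> by auto
  have int: "integrable M (\<lambda>\<omega>. ?Y r j (?V j \<omega>))" for r j
  proof (rule integrable_bounded[where C = 1])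
    show "(\<lambda>\<omega>. ?Y r j (?V j \<omega>)) \<in> borel_measurable M"
      by (rule measurable_compose[OF V]) simp
  qed (use s in \<open>auto simp: power_le_one\<close>)
  have mean: "expectation (\<lambda>\<omega>. s ^ \<tau> j \<omega>) = expectation (\<lambda>\<omega>. s ^ \<tau> 1 \<omega>)" if "1 \<le> j" for j
  proof -
    have "expectation (\<lambda>\<omega>. s ^ \<tau> j \<omega>) = (\<integral>k. s ^ k \<partial>distr M (count_space UNIV) (\<tau> j))"
      using \<tau>[OF that] by (subst integral_distr) auto
    also have "\<dots> = expectation (\<lambda>\<omega>. s ^ \<tau> 1 \<omega>)"
      unfolding ident[OF that] using \<tau>[of 1] by (subst integral_distr) auto
    finally show ?thesis .
  qed
  have prod_eq: "(\<Prod>j\<in>{0..r}. ?Y r j (?V j \<omega>)) = indicator {r} (\<Lambda> \<omega>) * (\<Prod>j = 1..r. s ^ \<tau> j \<omega>)" for r \<omega>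
  proof -
    have "{0..r} = insert 0 {1..r}" by auto
    moreover have "(\<Prod>j = 1..r. ?Y r j (?V j \<omega>)) = (\<Prod>j = 1..r. s ^ \<tau> j \<omega>)" by (intro prod.cong) auto
    ultimately show ?thesis by simp
  qed
  have term_eq: "expectation (\<lambda>\<omega>. \<Prod>j\<in>{0..r}. ?Y r j (?V j \<omega>)) =
      prob {\<omega> \<in> space M. \<Lambda> \<omega> = r} * expectation (\<lambda>\<omega>. s ^ \<tau> 1 \<omega>) ^ r"
    and term_int: "integrable M (\<lambda>\<omega>. \<Prod>j\<in>{0..r}. ?Y r j (?V j \<omega>))" for r
  proof -
    have ind: "indep_vars (\<lambda>_. borel) (\<lambda>j \<omega>. ?Y r j (?V j \<omega>)) {0..r}"
      by (rule indep_vars_compose2[OF indep_vars_subset[OF indep]]) auto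
    show "integrable M (\<lambda>\<omega>. \<Prod>j\<in>{0..r}. ?Y r j (?V j \<omega>))"
      by (rule indep_vars_integrable[OF _ ind int]) simp
    have "expectation (\<lambda>\<omega>. \<Prod>j\<in>{0..r}. ?Y r j (?V j \<omega>)) = (\<Prod>j\<in>{0..r}. expectation (\<lambda>\<omega>. ?Y r j (?V j \<omega>)))"
      by (rule indep_vars_lebesgue_integral[OF _ ind int]) simp
    also have "\<dots> = prob {\<omega> \<in> space M. \<Lambda> \<omega> = r} * expectation (\<lambda>\<omega>. s ^ \<tau> 1 \<omega>) ^ r"
    proof -
      have ins: "{0..r} = insert 0 {1..r}" by auto
      have "(\<Prod>j\<in>{1..r}. expectation (\<lambda>\<omega>. ?Y r j (?V j \<omega>))) = (\<Prod>j\<in>{1..r}. expectation (\<lambda>\<omega>. s ^ \<tau> 1 \<omega>))"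
      proof (rule prod.cong[OF refl])
        fix j assume "j \<in> {1..r}"
        then show "expectation (\<lambda>\<omega>. ?Y r j (?V j \<omega>)) = expectation (\<lambda>\<omega>. s ^ \<tau> 1 \<omega>)"
          using mean[of j] by simp
      qed
      moreover have "expectation (\<lambda>\<omega>. ?Y r 0 (?V 0 \<omega>)) = expectation (indicator {\<omega> \<in> space M. \<Lambda> \<omega> = r})"
        by (intro Bochner_Integration.integral_cong) (auto simp: indicator_def)
      ultimately show ?thesis unfolding ins by simp
    qed
    finally show "expectation (\<lambda>\<omega>. \<Prod>j\<in>{0..r}. ?Y r j (?V j \<omega>)) =
        prob {\<omega> \<in> space M. \<Lambda> \<omega> = r} * expectation (\<lambda>\<omega>. s ^ \<tau> 1 \<omega>) ^ r" .
  qed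
  have Y0: "0 \<le> (\<Prod>j\<in>{0..r}. ?Y r j (?V j \<omega>))" for r \<omega> using s by (intro prod_nonneg) auto
  have "ennreal (s ^ (\<Sum>j = 1..\<Lambda> \<omega>. \<tau> j \<omega>)) = (\<Sum>r. ennreal (\<Prod>j\<in>{0..r}. ?Y r j (?V j \<omega>)))" for \<omega>
  proof -
    have "(\<lambda>r. if r = \<Lambda> \<omega> then ennreal (s ^ (\<Sum>j = 1..r. \<tau> j \<omega>)) else 0) sums ennreal (s ^ (\<Sum>j = 1..\<Lambda> \<omega>. \<tau> j \<omega>))"
      by (rule sums_single)
    moreover have "(\<lambda>r. if r = \<Lambda> \<omega> then ennreal (s ^ (\<Sum>j = 1..r. \<tau> j \<omega>)) else 0) =
        (\<lambda>r. ennreal (\<Prod>j\<in>{0..r}. ?Y r j (?V j \<omega>)))"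
      unfolding prod_eq by (auto simp: fun_eq_iff power_sum indicator_def)
    ultimately show ?thesis by (simp add: sums_iff)
  qed
  then have "(\<integral>\<^sup>+\<omega>. ennreal (s ^ (\<Sum>j = 1..\<Lambda> \<omega>. \<tau> j \<omega>)) \<partial>M) =
      (\<integral>\<^sup>+\<omega>. (\<Sum>r. ennreal (\<Prod>j\<in>{0..r}. ?Y r j (?V j \<omega>))) \<partial>M)" by simp
  also have "\<dots> = (\<Sum>r. \<integral>\<^sup>+\<omega>. ennreal (\<Prod>j\<in>{0..r}. ?Y r j (?V j \<omega>)) \<partial>M)"
    by (rule nn_integral_suminf) (use term_int in \<open>auto dest: borel_measurable_integrable\<close>)
  also have "\<dots> = (\<Sum>r. ennreal (prob {\<omega> \<in> space M. \<Lambda> \<omega> = r} * expectation (\<lambda>\<omega>. s ^ \<tau> 1 \<omega>) ^ r))"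
    unfolding term_eq[symmetric]
    by (intro suminf_cong nn_integral_eq_integral term_int AE_I2 Y0)
  finally show ?thesis .
qed

text \<open>A Poisson weight is at most 1, as \<open>l ^ r / fact r\<close> is one term of the
  series for \<open>exp l\<close>; integrability thus asks for no moment of
  \<open>L\<close>.\<close>

lemma (in prob_space) mixed_poisson_weights:
  fixes L :: "'a \<Rightarrow> real"
  assumes L[measurable]: "L \<in> borel_measurable M" and L0: "AE x in M. 0 \<le> L x"
  shows "integrable M (\<lambda>x. exp (- L x) * (L x ^ r / fact r))"
    and "AE x in M. 0 \<le> exp (- L x) * (L x ^ r / fact r)"
proof -
  have le: "exp (- l) * (l ^ r / fact r) \<le> 1" if "0 \<le> l" for l :: real
  proof -
    have "(\<Sum>i\<in>{r}. l ^ i /\<^sub>R fact i) \<le> (\<Sum>i. l ^ i /\<^sub>R fact i)"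
      using that by (intro sum_le_suminf summable_exp_generic) auto
    then have "l ^ r / fact r \<le> exp l" by (simp add: exp_def field_simps)
    then show ?thesis by (simp add: exp_minus field_simps)
  qed
  show "AE x in M. 0 \<le> exp (- L x) * (L x ^ r / fact r)" using L0 by eventually_elim simp
  show "integrable M (\<lambda>x. exp (- L x) * (L x ^ r / fact r))"
    by (rule integrable_const_bound[where B = 1]) (use L0 le in \<open>auto elim!: eventually_mono\<close>)
qed

text \<open>The first identity is the generating function of a mixed Poisson law, the second its
  derivative in \<open>t\<close>, that is, the transform of the unnormalised size-biased law shifted
  by one. At \<open>t = 1\<close> the latter is the mean.\<close>

lemma (in prob_space) mixed_poisson_pgf:
  fixes L :: "'a \<Rightarrow> real" and t :: real
  assumes L[measurable]: "L \<in> borel_measurable M" and L0: "AE x in M. 0 \<le> L x" and t: "0 \<le> t"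
  shows "(\<Sum>r. ennreal (expectation (\<lambda>x. exp (- L x) * (L x ^ r / fact r)) * t ^ r)) =
      (\<integral>\<^sup>+x. ennreal (exp (- ((1 - t) * L x))) \<partial>M)"
    and "(\<Sum>r. ennreal (real (Suc r) * expectation (\<lambda>x. exp (- L x) * (L x ^ Suc r / fact (Suc r))) * t ^ r)) =
      (\<integral>\<^sup>+x. ennreal (L x * exp (- ((1 - t) * L x))) \<partial>M)"
proof -
  let ?w = "\<lambda>r x. exp (- L x) * (L x ^ r / fact r)"
  note w = mixed_poisson_weights[OF L L0]
  have coeff: "ennreal (c * expectation (?w r) * t ^ k) = (\<integral>\<^sup>+x. ennreal (c * ?w r x * t ^ k) \<partial>M)"
    if "0 \<le> c" for c r k
  proof -
    have "(\<integral>\<^sup>+x. ennreal (c * ?w r x * t ^ k) \<partial>M) = ennreal (expectation (\<lambda>x. c * ?w r x * t ^ k))"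
    proof (rule nn_integral_eq_integral)
      show "integrable M (\<lambda>x. c * ?w r x * t ^ k)"
        by (intro integrable_mult_left integrable_mult_right w(1))
      show "AE x in M. 0 \<le> c * ?w r x * t ^ k"
        using w(2)[of r] by eventually_elim (intro mult_nonneg_nonneg[of "c * _"] mult_nonneg_nonneg[OF that] zero_le_power t)
    qed
    then show ?thesis by simp
  qed
  have exp_sums: "(\<lambda>r. exp (- l) * (l ^ r / fact r) * t ^ r) sums exp (- ((1 - t) * l))" for l
  proof -
    have "(\<lambda>r. exp (- l) * ((l * t) ^ r /\<^sub>R fact r)) sums (exp (- l) * exp (l * t))"
      by (intro sums_mult exp_converges)
    then show ?thesis by (simp add: exp_add[symmetric] power_mult_distrib field_simps)
  qed
  have "(\<Sum>r. ennreal (1 * expectation (?w r) * t ^ r)) = (\<integral>\<^sup>+x. (\<Sum>r. ennreal (1 * ?w r x * t ^ r)) \<partial>M)"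
    unfolding coeff[OF zero_le_one] by (rule nn_integral_suminf[symmetric]) measurable
  also have "\<dots> = (\<integral>\<^sup>+x. ennreal (exp (- ((1 - t) * L x))) \<partial>M)"
  proof (rule nn_integral_cong_AE)
    show "AE x in M. (\<Sum>r. ennreal (1 * ?w r x * t ^ r)) = ennreal (exp (- ((1 - t) * L x)))"
      using L0
    proof eventually_elim
      case (elim x)
      then show ?case using exp_sums[of "L x"] t by (intro suminf_ennreal_eq) auto
    qed
  qed
  finally show "(\<Sum>r. ennreal (expectation (?w r) * t ^ r)) = (\<integral>\<^sup>+x. ennreal (exp (- ((1 - t) * L x))) \<partial>M)"
    by simp
  have "(\<Sum>r. ennreal (real (Suc r) * expectation (?w (Suc r)) * t ^ r)) = (\<integral>\<^sup>+x. (\<Sum>r. ennreal (real (Suc r) * ?w (Suc r) x * t ^ r)) \<partial>M)"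
    unfolding coeff[OF of_nat_0_le_iff] by (rule nn_integral_suminf[symmetric]) measurable
  also have "\<dots> = (\<integral>\<^sup>+x. ennreal (L x * exp (- ((1 - t) * L x))) \<partial>M)"
  proof (rule nn_integral_cong_AE)
    show "AE x in M. (\<Sum>r. ennreal (real (Suc r) * ?w (Suc r) x * t ^ r)) = ennreal (L x * exp (- ((1 - t) * L x)))"
      using L0
    proof eventually_elim
      case (elim x)
      \<comment> \<open>The Poisson identity (r + 1) w_{r+1} = l w_r reduces the derivative series
        to the exponential series.\<close>
      have "real (Suc r) * ?w (Suc r) x * t ^ r = L x * (exp (- L x) * (L x ^ r / fact r) * t ^ r)" for r
        by (simp add: field_simps del: of_nat_Suc)
      then show ?case using sums_mult[OF exp_sums[of "L x"], of "L x"] t elim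
        by (intro suminf_ennreal_eq) (simp_all del: power_Suc fact_Suc)
    qed
  qed
  finally show "(\<Sum>r. ennreal (real (Suc r) * expectation (?w (Suc r)) * t ^ r)) = (\<integral>\<^sup>+x. ennreal (L x * exp (- ((1 - t) * L x))) \<partial>M)" .
qed

text \<open>Writing \<open>G\<close> for the generating function of \<open>\<tau> 1\<close>, the
  compound law has transform equal to the mean of \<open>exp (- ((1 - G) * \<lambda>))\<close> with
  \<lambda> the Poisson parameter of the number of summands. It remains to see that this exponent is
  \<open>psi\<close>, which holds because \<open>G\<close> is the average of \<open>q\<close> under
  the size-biased \<open>P1\<close>.\<close>

lemma (in intersection_graph_limit) pgf_compound_eq:
  fixes N :: "'b measure" and \<Lambda>1 \<Lambda>2 :: "'b \<Rightarrow> nat" and \<tau> :: "nat \<Rightarrow> 'b \<Rightarrow> nat" and a1 :: real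
  assumes a1: "a1 = (\<integral>x. x \<partial>P1)" and N: "prob_space N"
    and L1: "\<Lambda>1 \<in> measurable N (count_space UNIV)" and L2: "\<Lambda>2 \<in> measurable N (count_space UNIV)"
    and \<tau>: "\<And>j. 1 \<le> j \<Longrightarrow> \<tau> j \<in> measurable N (count_space UNIV)"
    and L1_dist: "\<And>r. measure N {\<omega> \<in> space N. \<Lambda>1 \<omega> = r} =
           (\<integral>y. exp (- (y * a1 * sqrt \<beta>)) * ((y * a1 * sqrt \<beta>) ^ r / fact r) \<partial>P2)"
    and L2_dist: "\<And>r. measure N {\<omega> \<in> space N. \<Lambda>2 \<omega> = r} =
           (\<integral>x. exp (- (x * b1 / sqrt \<beta>)) * ((x * b1 / sqrt \<beta>) ^ r / fact r) \<partial>P1)"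
    and indep: "prob_space.indep_vars N (\<lambda>_. count_space UNIV) (\<lambda>j. if j = 0 then \<Lambda>1 else \<tau> j) UNIV"
    and ident: "\<And>j. 1 \<le> j \<Longrightarrow> distr N (count_space UNIV) (\<tau> j) = distr N (count_space UNIV) (\<tau> 1)"
    and \<tau>_dist: "\<And>r. (\<integral>\<omega>. real (\<Lambda>2 \<omega>) \<partial>N) \<noteq> 0 \<Longrightarrow>
           measure N {\<omega> \<in> space N. \<tau> 1 \<omega> = r} =
             (real r + 1) / (\<integral>\<omega>. real (\<Lambda>2 \<omega>) \<partial>N) * measure N {\<omega> \<in> space N. \<Lambda>2 \<omega> = r + 1}"
  shows "(\<integral>\<omega>. s ^ (\<Sum>j = 1..\<Lambda>1 \<omega>. \<tau> j \<omega>) \<partial>N) = (\<integral>y. exp (- psi y) \<partial>P2)"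
proof -
  interpret N: prob_space N by fact
  define G where "G = (\<integral>\<omega>. s ^ \<tau> 1 \<omega> \<partial>N)"
  let ?L1 = "\<lambda>y. y * a1 * sqrt \<beta>" and ?L2 = "\<lambda>x. x * b1 / sqrt \<beta>"
  define \<mu> where "\<mu> = (\<integral>\<omega>. real (\<Lambda>2 \<omega>) \<partial>N)"
  have a1_nonneg: "0 \<le> a1" unfolding a1 using nonneg1 by (rule integral_nonneg_AE)
  have L1_nonneg: "AE y in P2. 0 \<le> ?L1 y" using nonneg2 by eventually_elim (use a1_nonneg beta in simp)
  have L2_nonneg: "AE x in P1. 0 \<le> ?L2 x" using nonneg1 by eventually_elim (use b1_nonneg beta in simp)
  have G0: "0 \<le> G" unfolding G_def using s by simp

  \<comment> \<open>The mean of \<open>\<Lambda>2\<close> is read off from the differentiated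
    identity at \<open>t = 1\<close>; the shift of the sum drops only the term \<open>r = 0\<close>,
    which is 0.\<close>
  have "(\<integral>\<^sup>+\<omega>. ennreal (real (\<Lambda>2 \<omega>)) \<partial>N) = (\<Sum>r. ennreal (real r * measure N {\<omega> \<in> space N. \<Lambda>2 \<omega> = r}))"
    by (rule N.nn_integral_of_nat_rv[OF L2]) simp
  also have "\<dots> = (\<Sum>r. ennreal (real (Suc r) * measure N {\<omega> \<in> space N. \<Lambda>2 \<omega> = Suc r}))"
    by (subst suminf_offset[where i = 1]) (simp_all add: summableI)
  also have "\<dots> = (\<integral>\<^sup>+x. ennreal (?L2 x) \<partial>P1)"
    unfolding L2_dist using P1.mixed_poisson_pgf(2)[OF _ L2_nonneg, of 1] by simp
  also have "\<dots> = ennreal (a1 * b1 / sqrt \<beta>)"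
    using int1 L2_nonneg by (subst nn_integral_eq_integral) (auto simp: a1)
  finally have mu: "\<mu> = a1 * b1 / sqrt \<beta>"
    unfolding \<mu>_def using a1_nonneg b1_nonneg beta L2 by (subst integral_eq_nn_integral) auto

  have int_xq': "integrable P1 (\<lambda>x. x * q x)"
  proof -
    have "integrable P1 (\<lambda>x. x - x * (1 - q x))" using int1 int_xq by (rule Bochner_Integration.integrable_diff)
    then show ?thesis by (simp add: algebra_simps)
  qed
  have rate: "AE y in P2. (1 - G) * ?L1 y = psi y"
  proof (cases "\<mu> = 0")
    case False
    then have nz: "a1 \<noteq> 0" "b1 \<noteq> 0" by (auto simp: mu)
    have "(\<integral>\<^sup>+\<omega>. ennreal (s ^ \<tau> 1 \<omega>) \<partial>N) = (\<Sum>r. ennreal (s ^ r * measure N {\<omega> \<in> space N. \<tau> 1 \<omega> = r}))"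
      using s by (intro N.nn_integral_of_nat_rv \<tau>) auto
    also have "\<dots> = (\<Sum>r. ennreal (1 / \<mu>) * ennreal (real (Suc r) * measure N {\<omega> \<in> space N. \<Lambda>2 \<omega> = Suc r} * s ^ r))"
    proof (intro suminf_cong)
      fix r
      have "0 \<le> \<mu>" unfolding \<mu>_def by simp
      then show "ennreal (s ^ r * measure N {\<omega> \<in> space N. \<tau> 1 \<omega> = r}) =
          ennreal (1 / \<mu>) * ennreal (real (Suc r) * measure N {\<omega> \<in> space N. \<Lambda>2 \<omega> = Suc r} * s ^ r)"
        using \<tau>_dist[of r] False s by (simp add: \<mu>_def[symmetric] ennreal_mult[symmetric] ac_simps)
    qed
    also have "\<dots> = ennreal (1 / \<mu>) * (\<integral>\<^sup>+x. ennreal (?L2 x * q x) \<partial>P1)"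
      unfolding ennreal_suminf_cmult L2_dist q_def using P1.mixed_poisson_pgf(2)[OF _ L2_nonneg s(1)] by simp
    also have "(\<integral>\<^sup>+x. ennreal (?L2 x * q x) \<partial>P1) = ennreal (\<integral>x. ?L2 x * q x \<partial>P1)"
    proof (rule nn_integral_eq_integral)
      show "integrable P1 (\<lambda>x. ?L2 x * q x)" using integrable_mult_right[OF int_xq', of "b1 / sqrt \<beta>"] by (simp add: ac_simps)
      show "AE x in P1. 0 \<le> ?L2 x * q x" using L2_nonneg
        by eventually_elim (rule mult_nonneg_nonneg, assumption, simp add: q_def)
    qed
    also have "(\<integral>x. ?L2 x * q x \<partial>P1) = b1 / sqrt \<beta> * (\<integral>x. x * q x \<partial>P1)"
      by (simp add: ac_simps flip: integral_mult_right_zero)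
    finally have nnG: "(\<integral>\<^sup>+\<omega>. ennreal (s ^ \<tau> 1 \<omega>) \<partial>N) = ennreal (1 / \<mu>) * ennreal (b1 / sqrt \<beta> * (\<integral>x. x * q x \<partial>P1))" .
    have xq0: "0 \<le> (\<integral>x. x * q x \<partial>P1)"
      using nonneg1 by (intro integral_nonneg_AE) (auto elim!: eventually_mono simp: q_def)
    have "G = 1 / \<mu> * (b1 / sqrt \<beta> * (\<integral>x. x * q x \<partial>P1))"
      unfolding G_def using s \<tau>[of 1] nnG xq0 b1_nonneg a1_nonneg beta
      by (subst integral_eq_nn_integral) (auto simp: mu enn2real_mult)
    \<comment> \<open>The factor \<open>b1 / sqrt \<beta>\<close> cancels against \<mu>, leaving the
      normalising constant \<open>a1\<close> of size-biasing.\<close>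
    then have G: "a1 * G = (\<integral>x. x * q x \<partial>P1)" using nz beta by (simp add: mu)
    have D: "(\<integral>x. x * (1 - q x) \<partial>P1) = a1 - a1 * G"
      unfolding G
      using int1 int_xq' by (simp add: a1 right_diff_distrib)
    have "(1 - G) * ?L1 y = psi y" for y
      unfolding psi_def D by (simp add: algebra_simps)
    then show ?thesis by simp
  next
    case True
    \<comment> \<open>A vanishing mean forces one of the two weights to be 0 almost surely, and then
      both exponents are 0 whatever the value of \<open>G\<close>.\<close>
    then consider "a1 = 0" | "b1 = 0" using beta by (auto simp: mu)
    then show ?thesis
    proof cases
      case 1
      then have "AE x in P1. x = 0"
        using integral_nonneg_eq_0_iff_AE[OF int1 nonneg1] by (simp add: a1)
      then have "(\<integral>x. x * (1 - q x) \<partial>P1) = 0"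
        by (intro integral_eq_zero_AE) (auto elim!: eventually_mono)
      then show ?thesis using 1 by (simp add: psi_def)
    next
      case 2
      then have "AE y in P2. y = 0"
        using integral_nonneg_eq_0_iff_AE[OF int2 nonneg2] by (simp add: b1_def)
      then show ?thesis by eventually_elim (simp add: psi_def)
    qed
  qed

  have "(\<integral>\<^sup>+\<omega>. ennreal (s ^ (\<Sum>j = 1..\<Lambda>1 \<omega>. \<tau> j \<omega>)) \<partial>N) = (\<Sum>r. ennreal (measure N {\<omega> \<in> space N. \<Lambda>1 \<omega> = r} * G ^ r))"
    unfolding G_def by (rule N.nn_integral_power_compound[OF L1 \<tau> indep ident s])
  also have "\<dots> = (\<integral>\<^sup>+y. ennreal (exp (- ((1 - G) * ?L1 y))) \<partial>P2)"
    unfolding L1_dist by (rule P2.mixed_poisson_pgf(1)[OF _ L1_nonneg G0]) simp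
  also have "\<dots> = (\<integral>\<^sup>+y. ennreal (exp (- psi y)) \<partial>P2)"
    using rate by (intro nn_integral_cong_AE) (auto elim!: eventually_mono)
  finally have eq: "(\<integral>\<^sup>+\<omega>. ennreal (s ^ (\<Sum>j = 1..\<Lambda>1 \<omega>. \<tau> j \<omega>)) \<partial>N) = (\<integral>\<^sup>+y. ennreal (exp (- psi y)) \<partial>P2)" .
  have "(\<lambda>\<omega>. \<Sum>j = 1..\<Lambda>1 \<omega>. \<tau> j \<omega>) \<in> measurable N (count_space UNIV)"
    by (rule measurable_compose_countable[OF _ L1]) (use \<tau> in measurable)
  then have "(\<integral>\<omega>. s ^ (\<Sum>j = 1..\<Lambda>1 \<omega>. \<tau> j \<omega>) \<partial>N) = enn2real (\<integral>\<^sup>+\<omega>. ennreal (s ^ (\<Sum>j = 1..\<Lambda>1 \<omega>. \<tau> j \<omega>)) \<partial>N)"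
    using s by (intro integral_eq_nn_integral) auto
  also have "\<dots> = (\<integral>y. exp (- psi y) \<partial>P2)"
    unfolding eq by (intro integral_eq_nn_integral[symmetric]) (auto simp: psi_def)
  finally show ?thesis .
qed

theorem theorem1:
  fixes P1 P2 :: "real measure"
    and a\<^sub>1 b\<^sub>1 \<beta> :: real
    and n m :: "nat \<Rightarrow> nat"
    and N :: "'a measure"
    and \<Lambda>\<^sub>1 \<Lambda>\<^sub>2 :: "'a \<Rightarrow> nat"
    and \<tau> :: "nat \<Rightarrow> 'a \<Rightarrow> nat"
  assumes P1: "real_distribution P1" "AE x in P1. 0 \<le> x" "integrable P1 (\<lambda>x. x)"
    and P2: "real_distribution P2" "AE y in P2. 0 \<le> y" "integrable P2 (\<lambda>y. y)"
    and a\<^sub>1: "a\<^sub>1 = (\<integral>x. x \<partial>P1)"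
    and b\<^sub>1: "b\<^sub>1 = (\<integral>y. y \<partial>P2)"
    and \<beta>: "0 < \<beta>"
    and n: "filterlim n at_top sequentially"
    and m: "filterlim m at_top sequentially"
    and ratio: "(\<lambda>k. real (m k) / real (n k)) \<longlonglongrightarrow> \<beta>"
    and N: "prob_space N"
    and \<Lambda>\<^sub>1_rv: "\<Lambda>\<^sub>1 \<in> measurable N (count_space UNIV)"
    and \<Lambda>\<^sub>2_rv: "\<Lambda>\<^sub>2 \<in> measurable N (count_space UNIV)"
    and \<tau>_rv: "\<And>j. 1 \<le> j \<Longrightarrow> \<tau> j \<in> measurable N (count_space UNIV)"
    and \<Lambda>\<^sub>1_dist: "\<And>r. measure N {\<omega> \<in> space N. \<Lambda>\<^sub>1 \<omega> = r} =
           (\<integral>y. exp (- (y * a\<^sub>1 * sqrt \<beta>)) * ((y * a\<^sub>1 * sqrt \<beta>) ^ r / fact r) \<partial>P2)"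
    and \<Lambda>\<^sub>2_dist: "\<And>r. measure N {\<omega> \<in> space N. \<Lambda>\<^sub>2 \<omega> = r} =
           (\<integral>x. exp (- (x * b\<^sub>1 / sqrt \<beta>)) * ((x * b\<^sub>1 / sqrt \<beta>) ^ r / fact r) \<partial>P1)"
    and indep: "prob_space.indep_vars N (\<lambda>_. count_space UNIV)
           (\<lambda>j. if j = 0 then \<Lambda>\<^sub>1 else \<tau> j) UNIV"
    and \<tau>_ident: "\<And>j. 1 \<le> j \<Longrightarrow> distr N (count_space UNIV) (\<tau> j) = distr N (count_space UNIV) (\<tau> 1)"
    and \<tau>_dist: "\<And>r. (\<integral>\<omega>. real (\<Lambda>\<^sub>2 \<omega>) \<partial>N) \<noteq> 0 \<Longrightarrow>
           measure N {\<omega> \<in> space N. \<tau> 1 \<omega> = r} =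
             (real r + 1) / (\<integral>\<omega>. real (\<Lambda>\<^sub>2 \<omega>) \<partial>N) * measure N {\<omega> \<in> space N. \<Lambda>\<^sub>2 \<omega> = r + 1}"
  shows "weak_conv_m
           (\<lambda>k. distr (random_intersection_graph P1 P2 (n k) (m k)) borel (\<lambda>G. real (vertex_degree G 1)))
           (distr N borel (\<lambda>\<omega>. real (\<Sum>j = 1..\<Lambda>\<^sub>1 \<omega>. \<tau> j \<omega>)))"
proof (rule weak_conv_m_if_pgf_tendsto)
  show "prob_space (random_intersection_graph P1 P2 (n k) (m k))" for k
    by (rule prob_space_random_intersection_graph[OF P1(1) P2(1)])
  show "(\<lambda>G. vertex_degree G 1) \<in> measurable (random_intersection_graph P1 P2 (n k) (m k)) (count_space UNIV)" for k
    by (subst measurable_cong_sets[OF _ refl, where M' = "count_space UNIV"])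
      (simp_all add: sets_random_intersection_graph[OF P1(1) P2(1)])
  show "(\<lambda>\<omega>. \<Sum>j = 1..\<Lambda>\<^sub>1 \<omega>. \<tau> j \<omega>) \<in> measurable N (count_space UNIV)"
    by (rule measurable_compose_countable[OF _ \<Lambda>\<^sub>1_rv]) (use \<tau>_rv in measurable)
  fix s :: real assume s: "0 < s" "s < 1"
  interpret two_real_distributions P1 P2
    by (intro two_real_distributions.intro P1 P2)
  \<comment> \<open>A separate interpretation for each \<open>s\<close>, since \<open>q\<close>,
    \<open>phi\<close> and \<open>psi\<close> depend on it.\<close>
  interpret intersection_graph_limit P1 P2 n m \<beta> s
    using s by unfold_locales (simp_all add: P1 P2 \<beta> n m ratio)
  have b1: "b1 = b\<^sub>1" unfolding b1_def b\<^sub>1 ..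
  have "(\<integral>\<omega>. s ^ (\<Sum>j = 1..\<Lambda>\<^sub>1 \<omega>. \<tau> j \<omega>) \<partial>N) = (\<integral>y. exp (- psi y) \<partial>P2)"
    by (rule pgf_compound_eq[OF a\<^sub>1 N \<Lambda>\<^sub>1_rv \<Lambda>\<^sub>2_rv \<tau>_rv \<Lambda>\<^sub>1_dist _ indep \<tau>_ident \<tau>_dist, unfolded b1])
      (simp_all add: \<Lambda>\<^sub>2_dist)
  with pgf_degree_tendsto
  show "(\<lambda>k. \<integral>G. s ^ vertex_degree G 1 \<partial>random_intersection_graph P1 P2 (n k) (m k)) \<longlonglongrightarrow>
      (\<integral>\<omega>. s ^ (\<Sum>j = 1..\<Lambda>\<^sub>1 \<omega>. \<tau> j \<omega>) \<partial>N)" by simp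
qed (rule N)

end
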